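(* Let $F=f+\Psi$ on $\mathbb{R}^N$, the block partition, the constants $L_i>0$ and $\mu\ge 0$, and the norm $\|\cdot\|_L$ be as described in the context, so that $f$ has block-wise Lipschitz gradient with constants $L_1,\dots,L_n$ and satisfies the (strong) convexity inequality with parameter $\mu$. Let $F^\star$ be the optimal value of $\min_{x\in\mathbb{R}^N}F(x)$, let $X^\star$ be the set of its optimal solutions, assumed nonempty, and let $R_0=\min_{x^\star\in X^\star}\|x^{(0)}-x^\star\|_L$. Let $\{x^{(k)}\}$ be the sequence generated by the APCG method started from $x^{(0)}\in\mathrm{dom}(\Psi)$ with parameter $\gamma_0$, where $\gamma_0>0$ and $\gamma_0\in[\mu,1]$. Then for every $k\ge 0$, $$\mathbf{E}_{\xi_{k-1}}\big[F(x^{(k)})\big]-F^\star\;\le\;\min\left\{\left(1-\frac{\sqrt{\mu}}{n}\right)^k,\ \left(\frac{2n}{2n+k\sqrt{\gamma_0}}\right)^2\right\}\left(F(x^{(0)})-F^\star+\frac{\gamma_0}{2}R_0^2\right).$$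
   Context: Setting. $\mathbb{R}^N$ is partitioned into $n\ge1$ blocks of coordinates: $x=(x_1,\dots,x_n)$ (up to a permutation of coordinates) with $x_i\in\mathbb{R}^{N_i}$, $\sum_i N_i=N$, $N_i\ge1$. $U_i\in\mathbb{R}^{N\times N_i}$ is the matrix with $x=\sum_i U_ix_i$ and $x_i=U_i^Tx$. The problem is to minimize $F(x)=f(x)+\Psi(x)$ over $x\in\mathbb{R}^N$, where $f:\mathbb{R}^N\to\mathbb{R}$ is convex and differentiable, and $\Psi:\mathbb{R}^N\to(-\infty,\infty]$ is proper, lower semicontinuous, convex and block separable: $\Psi(x)=\sum_{i=1}^n\Psi_i(x_i)$. Write $\nabla_if(x)=U_i^T\nabla f(x)$. Smoothness assumption: there are constants $L_i>0$ with $\|\nabla_if(x+U_ih_i)-\nabla_if(x)\|_2\le L_i\|h_i\|_2$ for all $x\in\mathbb{R}^N$, $h_i\in\mathbb{R}^{N_i}$, $i=1,\dots,n$. Define $\|x\|_L=\big(\sum_{i=1}^nL_i\|x_i\|_2^2\big)^{1/2}$. Convexity assumption: $\mu\ge0$ satisfies $f(y)\ge f(x)+\langle\nabla f(x),y-x\rangle+\frac{\mu}{2}\|y-x\|_L^2$ for all $y\in\mathbb{R}^N$, $x\in\mathrm{dom}(\Psi)$. (These assumptions imply $\mu\le1$.) APCG method. Input: $x^{(0)}\in\mathrm{dom}(\Psi)$ and $\mu$. Set $z^{(0)}=x^{(0)}$ and choose $\gamma_0>0$ with $\gamma_0\in[\mu,1]$. For $k=0,1,2,\dots$: 1. Compute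 $\alpha_k\in(0,\frac1n]$ from $n^2\alpha_k^2=(1-\alpha_k)\gamma_k+\alpha_k\mu$, and set $\gamma_{k+1}=(1-\alpha_k)\gamma_k+\alpha_k\mu$, $\beta_k=\alpha_k\mu/\gamma_{k+1}$. 2. Set $y^{(k)}=\frac{1}{\alpha_k\gamma_k+\gamma_{k+1}}\big(\alpha_k\gamma_kz^{(k)}+\gamma_{k+1}x^{(k)}\big)$. 3. Choose $i_k\in\{1,\dots,n\}$ uniformly at random (independently of the past) and set $z^{(k+1)}=\arg\min_{x\in\mathbb{R}^N}\big\{\frac{n\alpha_k}{2}\|x-(1-\beta_k)z^{(k)}-\beta_ky^{(k)}\|_L^2+\langle\nabla_{i_k}f(y^{(k)}),x_{i_k}\rangle+\Psi_{i_k}(x_{i_k})\big\}$. 4. Set $x^{(k+1)}=y^{(k)}+n\alpha_k(z^{(k+1)}-z^{(k)})+\frac{\mu}{n}(z^{(k)}-y^{(k)})$. $\xi_k=\{i_0,\dots,i_k\}$, and $\mathbf{E}_{\xi_{k-1}}$ is expectation over $i_0,\dots,i_{k-1}$ (no randomness for $k=0$). *)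

theory Defs
  imports "HOL-Probability.Probability"
begin

text \<open>
  The partition of the coordinates \<open>'N\<close> into blocks is a surjective map
  \<open>blk :: 'N \<Rightarrow> 'b\<close>, so that \<open>n = CARD('b)\<close> and \<open>N\<^sub>i = card {j. blk j = i} \<ge> 1\<close>.
  The block space of dimension \<open>N\<^sub>i\<close> is identified, through the embedding \<open>U\<^sub>i\<close>, with
  the subspace of vectors that vanish outside block \<open>i\<close>.  Under this identification
  \<open>block_part blk i x\<close> is \<open>x\<^sub>i\<close> (literally, it is \<open>U\<^sub>i U\<^sub>i\<^sup>T x\<close>), and as \<open>h\<close> runs
  through the whole space, \<open>block_part blk i h\<close> runs through all \<open>U\<^sub>i h\<^sub>i\<close>.
\<close>

definition block_part :: "('N::finite \<Rightarrow> 'b) \<Rightarrow> 'b \<Rightarrow> real ^ 'N \<Rightarrow> real ^ 'N" where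
  "block_part blk i x = (\<chi> j. if blk j = i then x $ j else 0)"

definition block_norm :: "('N::finite \<Rightarrow> 'b::finite) \<Rightarrow> ('b \<Rightarrow> real) \<Rightarrow> real ^ 'N \<Rightarrow> real" where
  "block_norm blk L x = sqrt (\<Sum>i\<in>UNIV. L i * (norm (block_part blk i x))\<^sup>2)"

text \<open>Meaningful where \<open>f\<close> is differentiable, the gradient being unique there.\<close>

definition grad :: "('a::real_inner \<Rightarrow> real) \<Rightarrow> 'a \<Rightarrow> 'a" where
  "grad f x = (THE d. GDERIV f x :> d)"

text \<open>Notions for functions with values in the half-open interval \<open>(-\<infinity>, \<infinity>]\<close>.\<close>

definition ext_dom :: "('a \<Rightarrow> ereal) \<Rightarrow> 'a set" where
  "ext_dom g = {x. g x < \<infinity>}"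

definition proper_fun :: "('a \<Rightarrow> ereal) \<Rightarrow> bool" where
  "proper_fun g \<longleftrightarrow> (\<forall>x. g x \<noteq> -\<infinity>) \<and> ext_dom g \<noteq> {}"

definition lower_semicontinuous :: "('a::topological_space \<Rightarrow> ereal) \<Rightarrow> bool" where
  "lower_semicontinuous g \<longleftrightarrow> (\<forall>x. g x \<le> Liminf (at x) g)"

definition ext_convex :: "('a::real_vector \<Rightarrow> ereal) \<Rightarrow> bool" where
  "ext_convex g \<longleftrightarrow> (\<forall>x y. \<forall>t\<in>{0..1}.
     g ((1 - t) *\<^sub>R x + t *\<^sub>R y) \<le> ereal (1 - t) * g x + ereal t * g y)"

definition opt_value :: "('a \<Rightarrow> ereal) \<Rightarrow> ereal" where
  "opt_value F = (INF x. F x)"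

definition opt_set :: "('a \<Rightarrow> ereal) \<Rightarrow> 'a set" where
  "opt_set F = {x. F x = opt_value F}"

text \<open>
  Expectation of an extended-real random variable as the difference of the integrals of its
  positive and negative parts (\<open>e2ennreal\<close> maps negative numbers to \<open>0\<close>).  The
  Bochner integral is not used, since it would need a finite value assigned to \<open>\<infinity>\<close>.
  If both parts have infinite integral, the result is \<open>\<infinity>\<close>.
\<close>

definition ext_expectation :: "'w measure \<Rightarrow> ('w \<Rightarrow> ereal) \<Rightarrow> ereal" where
  "ext_expectation M X =
     enn2ereal (\<integral>\<^sup>+ w. e2ennreal (X w) \<partial>M) - enn2ereal (\<integral>\<^sup>+ w. e2ennreal (- X w) \<partial>M)"

definition apcg_params ::
    "nat \<Rightarrow> real \<Rightarrow> real \<Rightarrow> (nat \<Rightarrow> real) \<Rightarrow> (nat \<Rightarrow> real) \<Rightarrow> (nat \<Rightarrow> real) \<Rightarrow> bool" where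
  "apcg_params n \<mu> \<gamma>\<^sub>0 \<alpha> \<beta> \<gamma> \<longleftrightarrow>
     \<gamma> 0 = \<gamma>\<^sub>0 \<and>
     (\<forall>k. 0 < \<alpha> k \<and> \<alpha> k \<le> 1 / real n \<and>
          (real n)\<^sup>2 * (\<alpha> k)\<^sup>2 = (1 - \<alpha> k) * \<gamma> k + \<alpha> k * \<mu> \<and>
          \<gamma> (Suc k) = (1 - \<alpha> k) * \<gamma> k + \<alpha> k * \<mu> \<and>
          \<beta> k = \<alpha> k * \<mu> / \<gamma> (Suc k))"

text \<open>
  \<open>x\<close>, \<open>y\<close>, \<open>z\<close> are the sequences produced along one realisation \<open>idx\<close> of the chosen blocks;
  \<open>\<Psi>s i\<close> is only ever evaluated on the space of block \<open>i\<close>.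
\<close>

definition apcg_run ::
    "('N::finite \<Rightarrow> 'b::finite) \<Rightarrow> (real ^ 'N \<Rightarrow> real) \<Rightarrow> ('b \<Rightarrow> real ^ 'N \<Rightarrow> ereal) \<Rightarrow> ('b \<Rightarrow> real) \<Rightarrow> real \<Rightarrow>
     (nat \<Rightarrow> real) \<Rightarrow> (nat \<Rightarrow> real) \<Rightarrow> (nat \<Rightarrow> real) \<Rightarrow> real ^ 'N \<Rightarrow> (nat \<Rightarrow> 'b) \<Rightarrow>
     (nat \<Rightarrow> real ^ 'N) \<Rightarrow> (nat \<Rightarrow> real ^ 'N) \<Rightarrow> (nat \<Rightarrow> real ^ 'N) \<Rightarrow> bool" where
  "apcg_run blk f \<Psi>s L \<mu> \<alpha> \<beta> \<gamma> x\<^sub>0 idx x y z \<longleftrightarrow>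
     x 0 = x\<^sub>0 \<and> z 0 = x\<^sub>0 \<and>
     (\<forall>k.
        y k = (1 / (\<alpha> k * \<gamma> k + \<gamma> (Suc k))) *\<^sub>R ((\<alpha> k * \<gamma> k) *\<^sub>R z k + \<gamma> (Suc k) *\<^sub>R x k) \<and>
        is_arg_min
          (\<lambda>u. ereal (real CARD('b) * \<alpha> k / 2 *
                        (block_norm blk L (u - (1 - \<beta> k) *\<^sub>R z k - \<beta> k *\<^sub>R y k))\<^sup>2
                      + block_part blk (idx k) (grad f (y k)) \<bullet> block_part blk (idx k) u)
                + \<Psi>s (idx k) (block_part blk (idx k) u))
          (\<lambda>u. u \<in> UNIV) (z (Suc k)) \<and>
        x (Suc k) = y k + (real CARD('b) * \<alpha> k) *\<^sub>R (z (Suc k) - z k)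
                        + (\<mu> / real CARD('b)) *\<^sub>R (z k - y k))"

end

theory Submission
  imports Defs
begin

text \<open>
  Each \<open>x k\<close> is a convex combination of \<open>z 0, \<dots>, z k\<close>; let \<open>P k\<close> be the same combination of the
  values \<open>\<Psi> (z j)\<close>, so that \<open>\<Psi> (x k) \<le> P k\<close>.  Conditionally on the past, the potential
  \<open>f (x k) + P k - F u + \<gamma> k / 2 * \<parallel>z k - u\<parallel>\<^sub>L\<^sup>2\<close> shrinks in expectation by the factor \<open>1 - \<alpha> k\<close>:
  add the block descent inequality to the three-point inequality of the proximal step and average
  over the blocks.  The product of these factors is bounded through \<open>n \<alpha> k = sqrt (\<gamma> (Suc k))\<close>,
  \<open>\<mu> \<le> \<gamma> k\<close>, and the fact that \<open>\<gamma>\<^sub>0\<close> times the product is at most \<open>\<gamma> k\<close>.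
  Proximal points are unique and the blocks are uniform and independent, so the state at time \<open>k\<close> is
  a function of a uniformly distributed history of length \<open>k\<close>, and expectations are finite averages.
\<close>

section \<open>The scalar sequences\<close>

locale apcg_parameters =
  fixes n :: nat and \<mu> \<gamma>\<^sub>0 :: real and \<alpha> \<beta> \<gamma> :: "nat \<Rightarrow> real"
  assumes params: "apcg_params n \<mu> \<gamma>\<^sub>0 \<alpha> \<beta> \<gamma>"
    and n_pos: "n > 0"
    and mu_nonneg: "\<mu> \<ge> 0"
    and gamma0: "\<gamma>\<^sub>0 > 0" "\<gamma>\<^sub>0 \<in> {\<mu>..1}"
begin

lemma gamma0_eq: "\<gamma> 0 = \<gamma>\<^sub>0"
  using params unfolding apcg_params_def by blast

lemma alpha_pos: "\<alpha> k > 0"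
  and n_alpha_le_1: "real n * \<alpha> k \<le> 1"
  and gamma_Suc: "\<gamma> (Suc k) = (1 - \<alpha> k) * \<gamma> k + \<alpha> k * \<mu>"
  and gamma_Suc_sq: "\<gamma> (Suc k) = (real n * \<alpha> k)\<^sup>2"
  and beta_eq: "\<beta> k = \<alpha> k * \<mu> / \<gamma> (Suc k)"
  using params[unfolded apcg_params_def, THEN conjunct2, rule_format, of k] n_pos
  by (simp_all add: power_mult_distrib pos_le_divide_eq mult.commute)

lemma alpha_le_1: "\<alpha> k \<le> 1"
proof -
  have "1 * \<alpha> k \<le> real n * \<alpha> k"
    using n_pos alpha_pos[of k] by (intro mult_right_mono) auto
  then show ?thesis using n_alpha_le_1[of k] by linarith
qed

lemma gamma_pos: "\<gamma> k > 0"
proof (cases k)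
  case 0
  then show ?thesis using gamma0 by (simp add: gamma0_eq)
next
  case (Suc j)
  then show ?thesis using gamma_Suc_sq[of j] n_pos alpha_pos[of j] by simp
qed

lemma mu_le_gamma: "\<mu> \<le> \<gamma> k"
proof (induction k)
  case 0
  then show ?case using gamma0 by (simp add: gamma0_eq)
next
  case (Suc k)
  have "(1 - \<alpha> k) * \<mu> \<le> (1 - \<alpha> k) * \<gamma> k"
    using Suc alpha_le_1 by (intro mult_left_mono) auto
  then show ?case by (simp add: gamma_Suc algebra_simps)
qed

lemma gamma_Suc_le: "\<gamma> (Suc k) \<le> \<gamma> k"
proof -
  have "\<alpha> k * \<mu> \<le> \<alpha> k * \<gamma> k"
    using mu_le_gamma alpha_pos[of k] by (intro mult_left_mono) auto
  then show ?thesis by (simp add: gamma_Suc algebra_simps)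
qed

text \<open>After multiplication by \<open>n\<close>, the squares of the two sides are consecutive
  values of \<open>\<gamma>\<close>, which decrease.\<close>

lemma alpha_Suc_le: "\<alpha> (Suc k) \<le> \<alpha> k"
proof -
  have "0 \<le> real n * \<alpha> k"
    using alpha_pos[of k] by simp
  then have "real n * \<alpha> (Suc k) \<le> real n * \<alpha> k"
    using gamma_Suc_le[of "Suc k"] unfolding gamma_Suc_sq by (rule power2_le_imp_le[rotated])
  then show ?thesis
    using n_pos mult_le_cancel_left_pos[of "real n"] by simp
qed

lemma beta_nonneg: "0 \<le> \<beta> k"
  using alpha_pos[of k] gamma_pos[of "Suc k"] mu_nonneg by (simp add: beta_eq)

lemma beta_le_1: "\<beta> k \<le> 1"
proof -
  have "0 \<le> (1 - \<alpha> k) * \<gamma> k"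
    using alpha_le_1[of k] gamma_pos[of k] by simp
  then have "\<alpha> k * \<mu> \<le> \<gamma> (Suc k)"
    by (simp add: gamma_Suc)
  then show ?thesis using gamma_pos[of "Suc k"] by (simp add: beta_eq)
qed

lemma gamma_beta: "\<gamma> (Suc k) * \<beta> k = \<alpha> k * \<mu>"
  using gamma_pos[of "Suc k"] by (simp add: beta_eq)

text \<open>Writing \<open>\<gamma> (Suc k)\<close> as a square in \<open>gamma_beta\<close> allows
  one factor \<open>\<alpha> k\<close> to cancel. The identity lets \<open>run_x\<close> absorb the
  correction term of the \<open>x\<close> update into a displacement from the proximal
  centre.\<close>

lemma n_alpha_beta: "real n * \<alpha> k * \<beta> k = \<mu> / n"
proof -
  have "real n * (real n * \<alpha> k * \<beta> k) * \<alpha> k = \<alpha> k * \<mu>"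
    using gamma_beta[of k] by (simp add: gamma_Suc_sq power2_eq_square mult_ac)
  then have "real n * (real n * \<alpha> k * \<beta> k) = \<mu>"
    using alpha_pos[of k] by (simp add: mult_ac)
  then show ?thesis using n_pos by (simp add: field_simps)
qed

text \<open>
  The method satisfies \<open>y k = (1 - \<tau> k) x k + \<tau> k z k\<close> and \<open>x k = q k + \<theta> k z k\<close>, where
  \<open>q 0 = 0\<close> and \<open>q (Suc k) = \<sigma> k q k + \<kappa> k z k\<close>.
\<close>

definition \<tau> :: "nat \<Rightarrow> real" where
  "\<tau> k = \<alpha> k * \<gamma> k / (\<alpha> k * \<gamma> k + \<gamma> (Suc k))"

fun \<theta> :: "nat \<Rightarrow> real" where
  "\<theta> 0 = 1"
| "\<theta> (Suc k) = real n * \<alpha> k"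

definition \<sigma> :: "nat \<Rightarrow> real" where
  "\<sigma> k = (1 - \<mu> / n) * (1 - \<tau> k)"

definition \<kappa> :: "nat \<Rightarrow> real" where
  "\<kappa> k = (1 - \<mu> / n) * ((1 - \<tau> k) * \<theta> k + \<tau> k) - real n * \<alpha> k * (1 - \<beta> k)"

lemma tau_denom: "\<alpha> k * \<gamma> k + \<gamma> (Suc k) > 0"
  using alpha_pos gamma_pos by (simp add: add_pos_pos)

lemma tau_bounds: "0 \<le> \<tau> k" "\<tau> k \<le> 1"
  using alpha_pos[of k] gamma_pos[of k] gamma_pos[of "Suc k"] tau_denom[of k]
  by (auto simp: \<tau>_def)

lemma one_minus_tau: "1 - \<tau> k = \<gamma> (Suc k) / (\<alpha> k * \<gamma> k + \<gamma> (Suc k))"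
  using tau_denom[of k] by (simp add: \<tau>_def field_simps)

text \<open>By the recursion for \<open>\<gamma>\<close>, the denominator of \<open>\<tau> k\<close>
  is \<open>\<gamma> k + \<alpha> k * \<mu>\<close>, and
  \<open>\<gamma> (Suc k) * (1 - \<alpha> k * \<beta> k)\<close> contains the same factor.
  \<open>alpha_beta_tau\<close> and the two expected-weight identities rest on this.\<close>

lemma one_minus_tau_times: "(1 - \<tau> k) * (1 - \<alpha> k * \<beta> k) = 1 - \<alpha> k"
proof -
  have den: "\<alpha> k * \<gamma> k + \<gamma> (Suc k) = \<gamma> k + \<alpha> k * \<mu>"
    by (simp add: gamma_Suc algebra_simps)
  have "(1 - \<tau> k) * (1 - \<alpha> k * \<beta> k) * (\<gamma> k + \<alpha> k * \<mu>) = \<gamma> (Suc k) * (1 - \<alpha> k * \<beta> k)"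
    using tau_denom[of k] by (simp add: one_minus_tau den)
  also have "\<dots> = \<gamma> (Suc k) - \<alpha> k * (\<alpha> k * \<mu>)"
    using gamma_beta[of k] by (simp add: algebra_simps)
  also have "\<dots> = (1 - \<alpha> k) * (\<gamma> k + \<alpha> k * \<mu>)"
    by (simp add: gamma_Suc algebra_simps)
  finally show ?thesis
    using tau_denom[of k] by (simp add: den)
qed

lemma alpha_beta_tau: "\<alpha> k * (1 - \<beta> k) * (1 - \<tau> k) = (1 - \<alpha> k) * \<tau> k"
  using one_minus_tau_times[of k] by (simp add: algebra_simps)

lemma mu_le_n: "\<mu> / n \<le> 1"
proof -
  have "\<mu> \<le> 1" using gamma0 by simp
  also have "1 \<le> real n" using n_pos by simp
  finally show ?thesis using n_pos by simp
qed

lemma theta_bounds: "0 \<le> \<theta> k" "\<theta> k \<le> 1" "real n * \<alpha> k \<le> \<theta> k"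
proof -
  have "0 \<le> \<theta> k \<and> \<theta> k \<le> 1 \<and> real n * \<alpha> k \<le> \<theta> k"
  proof (cases k)
    case 0
    then show ?thesis using n_alpha_le_1[of 0] by simp
  next
    case (Suc j)
    then show ?thesis
      using n_alpha_le_1[of j] alpha_pos[of j] alpha_Suc_le[of j] by (simp add: mult_left_mono)
  qed
  then show "0 \<le> \<theta> k" "\<theta> k \<le> 1" "real n * \<alpha> k \<le> \<theta> k"
    by auto
qed

lemma sigma_bounds: "0 \<le> \<sigma> k" "\<sigma> k \<le> 1"
  using tau_bounds[of k] mu_le_n mu_nonneg n_pos by (auto simp: \<sigma>_def intro!: mult_le_one)

text \<open>This keeps the weights of the points \<open>z j\<close> in \<open>x k\<close>
  nonnegative. Mixing \<open>\<theta> k \<le> 1\<close> with 1 cannot lower it, and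
  \<open>n_alpha_beta\<close> then reduces the claim to
  \<open>n * \<alpha> k \<le> \<theta> k\<close>.\<close>

lemma kappa_nonneg: "0 \<le> \<kappa> k"
proof -
  have "0 \<le> \<theta> k - real n * \<alpha> k + \<mu> / n * (1 - \<theta> k)"
    using theta_bounds[of k] mu_nonneg by simp
  also have "\<dots> = (1 - \<mu> / n) * \<theta> k - real n * \<alpha> k * (1 - \<beta> k)"
    using n_alpha_beta[of k] by (simp add: algebra_simps)
  also have "\<dots> \<le> \<kappa> k"
  proof -
    have "0 \<le> \<tau> k * (1 - \<theta> k)" using tau_bounds theta_bounds by simp
    then have "\<theta> k \<le> (1 - \<tau> k) * \<theta> k + \<tau> k" by (simp add: algebra_simps)
    then show ?thesis using mu_le_n by (simp add: \<kappa>_def mult_left_mono)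
  qed
  finally show ?thesis .
qed

text \<open>The weights carried over from earlier points sum to \<open>1 - \<theta> k\<close>; so
  the weights in \<open>x (Suc k)\<close> again sum to one.\<close>

lemma weights_sum: "\<sigma> k * (1 - \<theta> k) + \<kappa> k + real n * \<alpha> k = 1"
  using n_alpha_beta[of k] by (simp add: \<sigma>_def \<kappa>_def algebra_simps diff_divide_distrib)

text \<open>The left side is the coefficient that \<open>P k\<close> receives in the sum over the
  chosen block, divided by \<open>n\<close>. The factor \<open>n - 1\<close> counts the choices that
  leave a given block at its value in the proximal centre.\<close>

lemma expected_weight_prev: "\<sigma> k + (real n - 1) * (\<alpha> k * (\<beta> k * (1 - \<tau> k))) = 1 - \<alpha> k"
proof -
  have "\<sigma> k + (real n - 1) * (\<alpha> k * (\<beta> k * (1 - \<tau> k)))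
      = (1 - \<tau> k) * (1 - \<mu> / n + real n * \<alpha> k * \<beta> k - \<alpha> k * \<beta> k)"
    by (simp add: \<sigma>_def algebra_simps)
  then show ?thesis
    unfolding n_alpha_beta using one_minus_tau_times[of k] by simp
qed

text \<open>The companion identity: what is left of \<open>\<Psi> (z k)\<close> once
  \<open>P k\<close> has been collected cancels in the same average.\<close>

lemma expected_weight_current:
  "\<kappa> k - \<sigma> k * \<theta> k + (real n - 1) * (\<alpha> k * (1 - \<beta> k + \<beta> k * \<tau> k)) = 0"
proof -
  have "\<kappa> k - \<sigma> k * \<theta> k + (real n - 1) * (\<alpha> k * (1 - \<beta> k + \<beta> k * \<tau> k))
     = (1 - \<mu> / n + real n * \<alpha> k * \<beta> k) * \<tau> k - \<alpha> k * (1 - \<beta> k + \<beta> k * \<tau> k)"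
    by (simp add: \<sigma>_def \<kappa>_def algebra_simps)
  also have "\<dots> = (1 - \<alpha> k * \<beta> k) * \<tau> k - \<alpha> k * (1 - \<beta> k)"
    unfolding n_alpha_beta by (simp add: algebra_simps)
  also have "\<dots> = 0"
    using one_minus_tau_times[of k] by (simp add: algebra_simps)
  finally show ?thesis .
qed

section \<open>Decay of the product of the factors 1 - \<alpha> j\<close>

definition contraction :: "nat \<Rightarrow> real" where
  "contraction k = (\<Prod>j<k. 1 - \<alpha> j)"

lemma contraction_nonneg: "0 \<le> contraction k"
  using alpha_le_1 by (auto simp: contraction_def intro!: prod_nonneg)

lemma contraction_Suc: "contraction (Suc k) = (1 - \<alpha> k) * contraction k"
  by (simp add: contraction_def)

lemma n_alpha_eq_sqrt: "real n * \<alpha> k = sqrt (\<gamma> (Suc k))"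
  using alpha_pos[of k] by (simp add: gamma_Suc_sq)

lemma contraction_le_linear: "contraction k \<le> (1 - sqrt \<mu> / n) ^ k"
proof -
  have "sqrt \<mu> / n \<le> \<alpha> j" for j
  proof -
    have "sqrt \<mu> \<le> real n * \<alpha> j"
      using mu_le_gamma[of "Suc j"] by (simp add: n_alpha_eq_sqrt)
    then show ?thesis using n_pos by (simp add: field_simps)
  qed
  then have "contraction k \<le> (\<Prod>j<k. 1 - sqrt \<mu> / n)"
    unfolding contraction_def using alpha_le_1 by (intro prod_mono) auto
  then show ?thesis by simp
qed

text \<open>Dropping the nonnegative term \<open>\<alpha> k * \<mu>\<close> from the recursion for
  \<open>\<gamma>\<close> leaves the recursion of the product.\<close>

lemma gamma_ge_contraction: "\<gamma>\<^sub>0 * contraction k \<le> \<gamma> k"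
proof (induction k)
  case 0
  then show ?case by (simp add: contraction_def gamma0_eq)
next
  case (Suc k)
  have "(1 - \<alpha> k) * (\<gamma>\<^sub>0 * contraction k) \<le> (1 - \<alpha> k) * \<gamma> k"
    using Suc alpha_le_1 by (intro mult_left_mono) auto
  also have "\<dots> \<le> \<gamma> (Suc k)"
    using alpha_pos[of k] mu_nonneg by (simp add: gamma_Suc)
  finally show ?case by (simp add: contraction_Suc mult_ac)
qed

text \<open>For positive square roots \<open>u\<close>, \<open>v\<close> of consecutive products
  this is \<open>1 / v - 1 / u \<ge> sqrt \<gamma>\<^sub>0 / (2 * n)\<close> multiplied out, a form
  that also covers a vanishing product.\<close>

lemma sqrt_contraction_step:
  "sqrt (contraction (Suc k)) * (2 * real n + sqrt \<gamma>\<^sub>0 * sqrt (contraction k)) \<le> 2 * real n * sqrt (contraction k)"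
proof -
  define u v where "u = sqrt (contraction k)" and "v = sqrt (contraction (Suc k))"
  have uv: "0 \<le> u" "0 \<le> v" and "u\<^sup>2 = contraction k" "v\<^sup>2 = contraction (Suc k)"
    using contraction_nonneg[of k] contraction_nonneg[of "Suc k"] by (simp_all add: u_def v_def)
  then have sq: "v\<^sup>2 = (1 - \<alpha> k) * u\<^sup>2"
    by (simp add: contraction_Suc)
  have "sqrt (\<gamma>\<^sub>0 * contraction (Suc k)) \<le> real n * \<alpha> k"
    unfolding n_alpha_eq_sqrt using gamma_ge_contraction by (rule real_sqrt_le_mono)
  then have a: "sqrt \<gamma>\<^sub>0 * v \<le> real n * \<alpha> k"
    by (simp add: v_def real_sqrt_mult)
  have "0 \<le> \<alpha> k * u\<^sup>2"
    using alpha_pos[of k] by simp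
  then have "v\<^sup>2 \<le> u\<^sup>2"
    by (simp add: sq algebra_simps)
  then have vu: "v \<le> u"
    using uv(1) by (rule power2_le_imp_le)
  show ?thesis
  proof (cases "u = 0")
    case True
    then have "v = 0" using vu uv by linarith
    then show ?thesis using True unfolding u_def[symmetric] v_def[symmetric] by simp
  next
    case False
    \<comment> \<open>The decrease \<open>u\<^sup>2 - v\<^sup>2\<close> is
      \<open>\<alpha> k * u\<^sup>2\<close>; factoring it and bounding \<open>u + v\<close> by
      \<open>2 * u\<close> produces the constant 2.\<close>
    have "u * (sqrt \<gamma>\<^sub>0 * v * u) \<le> u * (real n * \<alpha> k * u)"
      using a uv by (intro mult_left_mono mult_right_mono) auto
    also have "\<dots> = real n * (u\<^sup>2 - v\<^sup>2)"
      unfolding sq by (simp add: power2_eq_square algebra_simps)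
    also have "\<dots> = (u - v) * (real n * (u + v))"
      by (simp add: power2_eq_square algebra_simps)
    also have "\<dots> \<le> (u - v) * (real n * (u + u))"
      using vu by (intro mult_left_mono) auto
    finally have "u * (sqrt \<gamma>\<^sub>0 * v * u) \<le> u * (2 * real n * (u - v))"
      by (simp add: algebra_simps)
    then have "sqrt \<gamma>\<^sub>0 * v * u \<le> 2 * real n * (u - v)"
      by (rule mult_left_le_imp_le) (use False uv in simp)
    then show ?thesis unfolding u_def[symmetric] v_def[symmetric] by (simp add: algebra_simps)
  qed
qed

text \<open>The reciprocal square root starts at 1 and grows by at least
  \<open>sqrt \<gamma>\<^sub>0 / (2 * n)\<close> per step; the sum of these increments is again
  stated without division.\<close>

lemma sqrt_contraction_le: "sqrt (contraction k) * (2 * real n + real k * sqrt \<gamma>\<^sub>0) \<le> 2 * real n"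
proof (induction k)
  case 0
  then show ?case by (simp add: contraction_def)
next
  case (Suc k)
  define u v g where "u = sqrt (contraction k)" and "v = sqrt (contraction (Suc k))" and "g = sqrt \<gamma>\<^sub>0"
  have uv: "0 \<le> u" "0 \<le> v" "0 \<le> g"
    using contraction_nonneg gamma0 by (auto simp: u_def v_def g_def)
  have step: "v * (2 * real n + g * u) \<le> 2 * real n * u" and IH: "u * (2 * real n + k * g) \<le> 2 * real n"
    using sqrt_contraction_step[of k] Suc by (auto simp: u_def v_def g_def)
  show ?case
  proof (cases "u = 0")
    case True
    then have "v * (2 * real n) \<le> 0" using step by simp
    then have "v = 0" using uv n_pos by (simp add: mult_le_0_iff)
    then show ?thesis unfolding v_def[symmetric] by simp
  next
    case False
    have "u * (v * (2 * real n + Suc k * g)) = v * (u * (2 * real n + k * g)) + v * (g * u)"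
      by (simp add: algebra_simps)
    also have "\<dots> \<le> v * (2 * real n) + v * (g * u)"
      using IH uv by (intro add_mono mult_left_mono) auto
    also have "\<dots> \<le> u * (2 * real n)"
      using step by (simp add: algebra_simps)
    finally have "v * (2 * real n + Suc k * g) \<le> 2 * real n"
      by (rule mult_left_le_imp_le) (use False uv in simp)
    then show ?thesis by (simp only: v_def g_def)
  qed
qed

lemma contraction_le_sublinear: "contraction k \<le> (2 * real n / (2 * real n + real k * sqrt \<gamma>\<^sub>0))\<^sup>2"
proof -
  have "0 < 2 * real n + real k * sqrt \<gamma>\<^sub>0"
    using n_pos gamma0 by (simp add: add_pos_nonneg)
  then have "sqrt (contraction k) \<le> 2 * real n / (2 * real n + real k * sqrt \<gamma>\<^sub>0)"
    using sqrt_contraction_le[of k] by (simp add: field_simps)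
  then have "(sqrt (contraction k))\<^sup>2 \<le> (2 * real n / (2 * real n + real k * sqrt \<gamma>\<^sub>0))\<^sup>2"
    using contraction_nonneg by (intro power_mono) auto
  then show ?thesis using contraction_nonneg by simp
qed

end

section \<open>Blocks and the weighted block norm\<close>

lemma block_part_0 [simp]: "block_part blk i 0 = 0"
  and block_part_add [simp]: "block_part blk i (u + v) = block_part blk i u + block_part blk i v"
  and block_part_diff [simp]: "block_part blk i (u - v) = block_part blk i u - block_part blk i v"
  and block_part_scaleR [simp]: "block_part blk i (c *\<^sub>R u) = c *\<^sub>R block_part blk i u"
  and block_part_idem [simp]: "block_part blk i (block_part blk i u) = block_part blk i u"
  by (simp_all add: block_part_def vec_eq_iff)

lemma block_part_other [simp]: "i \<noteq> j \<Longrightarrow> block_part blk i (block_part blk j u) = 0"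
  by (simp add: block_part_def vec_eq_iff)

lemma block_part_sum: "(\<Sum>i\<in>UNIV. block_part blk i u) = u"
  for blk :: "'N::finite \<Rightarrow> 'b::finite"
  by (simp add: block_part_def vec_eq_iff sum.delta)

lemma block_part_eqI:
  fixes blk :: "'N::finite \<Rightarrow> 'b::finite"
  assumes "\<And>i. block_part blk i u = block_part blk i v"
  shows "u = v"
  by (metis assms block_part_sum sum.cong)

text \<open>\<open>block_part blk i\<close> is an orthogonal projection.\<close>

lemma inner_block_part: "block_part blk i u \<bullet> block_part blk i v = u \<bullet> block_part blk i v"
  by (auto simp: block_part_def inner_vec_def intro: sum.cong)

lemma sum_inner_block_part:
  fixes blk :: "'N::finite \<Rightarrow> 'b::finite"
  shows "(\<Sum>i\<in>UNIV. u \<bullet> block_part blk i v) = u \<bullet> v"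
  by (simp flip: inner_sum_right add: block_part_sum)

lemma block_norm_sq:
  assumes "\<And>i. 0 < L i"
  shows "(block_norm blk L u)\<^sup>2 = (\<Sum>i\<in>UNIV. L i * (norm (block_part blk i u))\<^sup>2)"
  unfolding block_norm_def
  by (rule real_sqrt_pow2) (intro sum_nonneg mult_nonneg_nonneg less_imp_le[OF assms] zero_le_power2)

lemma block_norm_minus_commute: "block_norm blk L (u - v) = block_norm blk L (v - u)"
  by (simp add: block_norm_def norm_minus_commute)

text \<open>The exact last term yields the gain in \<open>prox_three_point\<close>;
  \<open>block_norm_sq_convex\<close> uses only its sign.\<close>

lemma norm_convex_combination_sq:
  fixes a b :: "'a::real_inner"
  shows "(norm ((1 - t) *\<^sub>R a + t *\<^sub>R b))\<^sup>2
    = (1 - t) * (norm a)\<^sup>2 + t * (norm b)\<^sup>2 - t * (1 - t) * (norm (a - b))\<^sup>2"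
  by (simp add: power2_norm_eq_inner inner_simps inner_commute algebra_simps)

lemma block_norm_sq_convex:
  assumes "\<And>i. 0 < L i" "0 \<le> t" "t \<le> 1"
  shows "(block_norm blk L ((1 - t) *\<^sub>R u + t *\<^sub>R v))\<^sup>2
    \<le> (1 - t) * (block_norm blk L u)\<^sup>2 + t * (block_norm blk L v)\<^sup>2"
proof -
  have "L i * (norm (block_part blk i ((1 - t) *\<^sub>R u + t *\<^sub>R v)))\<^sup>2
      \<le> (1 - t) * (L i * (norm (block_part blk i u))\<^sup>2) + t * (L i * (norm (block_part blk i v))\<^sup>2)" for i
  proof -
    have "(norm ((1 - t) *\<^sub>R block_part blk i u + t *\<^sub>R block_part blk i v))\<^sup>2
        \<le> (1 - t) * (norm (block_part blk i u))\<^sup>2 + t * (norm (block_part blk i v))\<^sup>2"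
      unfolding norm_convex_combination_sq using assms by simp
    then have "L i * (norm (block_part blk i ((1 - t) *\<^sub>R u + t *\<^sub>R v)))\<^sup>2
        \<le> L i * ((1 - t) * (norm (block_part blk i u))\<^sup>2 + t * (norm (block_part blk i v))\<^sup>2)"
      unfolding block_part_add block_part_scaleR using assms(1)[of i] by (intro mult_left_mono) auto
    then show ?thesis by (simp only: distrib_left mult.left_commute)
  qed
  then show ?thesis
    unfolding block_norm_sq[of L, OF assms(1)] sum_distrib_left
    by (simp only: sum.distrib[symmetric]) (rule sum_mono)
qed

section \<open>Gradients and the block descent inequality\<close>

text \<open>The gradient is the Riesz representer of the derivative, assembled from its values on
  the basis. Testing two representers on their difference shows that they coincide, which justifies
  the definite description in \<open>grad\<close>.\<close>

lemma GDERIV_grad: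
  fixes f :: "'a::euclidean_space \<Rightarrow> real"
  assumes "f differentiable (at u)"
  shows "GDERIV f u :> grad f u"
proof -
  obtain f' where f': "(f has_derivative f') (at u)"
    using assms by (auto simp: differentiable_def)
  have "f' h = h \<bullet> (\<Sum>b\<in>Basis. f' b *\<^sub>R b)" for h
  proof -
    have "f' h = f' (\<Sum>b\<in>Basis. (h \<bullet> b) *\<^sub>R b)"
      unfolding euclidean_representation ..
    also have "\<dots> = (\<Sum>b\<in>Basis. (h \<bullet> b) * f' b)"
      using has_derivative_linear[OF f'] by (simp add: linear_sum linear_scale)
    finally show ?thesis
      by (simp add: inner_sum_right mult.commute)
  qed
  then have ex: "GDERIV f u :> (\<Sum>b\<in>Basis. f' b *\<^sub>R b)"
    unfolding gderiv_def by (intro has_derivative_eq_rhs[OF f'] ext)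
  have "d = e" if "GDERIV f u :> d" "GDERIV f u :> e" for d e
  proof -
    have "(\<lambda>h. h \<bullet> d) = (\<lambda>h. h \<bullet> e)"
      using that unfolding gderiv_def by (rule has_derivative_unique)
    then have "(d - e) \<bullet> d = (d - e) \<bullet> e" by (rule fun_cong)
    then have "(d - e) \<bullet> (d - e) = 0" by (simp only: inner_diff_right)
    then show "d = e" by simp
  qed
  then show ?thesis
    unfolding grad_def using ex by (intro theI[where P = "\<lambda>d. GDERIV f u :> d"]) blast+
qed

text \<open>Subtracting the quadratic model leaves a function with nonpositive derivative for
  \<open>t \<ge> 0\<close>; comparing its endpoint values replaces integration.\<close>

lemma descent_along_segment:
  assumes deriv: "\<And>t. ((\<lambda>t. g t) has_real_derivative g' t) (at t)"
    and lip: "\<And>t. 0 \<le> t \<Longrightarrow> g' t - g' 0 \<le> c * t"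
  shows "g 1 \<le> g 0 + g' 0 + c / 2"
proof -
  let ?h = "\<lambda>t. g t - t * g' 0 - c / 2 * t\<^sup>2"
  have "?h 1 \<le> ?h 0"
  proof (rule DERIV_nonpos_imp_nonincreasing[of 0 1 ?h])
    fix t :: real assume "0 \<le> t"
    have "(?h has_real_derivative g' t - g' 0 - c * t) (at t)"
      by (auto intro!: derivative_eq_intros deriv)
    then show "\<exists>d. (?h has_real_derivative d) (at t) \<and> d \<le> 0"
      using lip[OF \<open>0 \<le> t\<close>] by (intro exI[of _ "g' t - g' 0 - c * t"]) auto
  qed simp
  then show ?thesis by simp
qed

text \<open>The one-dimensional bound with \<open>c = l * (norm d)\<^sup>2\<close>. As
  \<open>d\<close> lies in block \<open>i\<close>, its inner product with the gradient sees only the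
  block gradient, and Cauchy-Schwarz brings in the constant \<open>l\<close>.\<close>

lemma block_descent:
  assumes grad: "\<And>v. GDERIV f v :> grad f v"
    and smooth: "\<And>v h. norm (block_part blk i (grad f (v + block_part blk i h)) - block_part blk i (grad f v))
            \<le> l * norm (block_part blk i h)"
  shows "f (u + block_part blk i h) \<le> f u + grad f u \<bullet> block_part blk i h + l / 2 * (norm (block_part blk i h))\<^sup>2"
proof -
  define d where "d = block_part blk i h"
  have dd: "block_part blk i d = d" by (simp add: d_def)
  have deriv: "((\<lambda>t. f (u + t *\<^sub>R d)) has_real_derivative grad f (u + t *\<^sub>R d) \<bullet> d) (at t)" for t
  proof -
    have "((\<lambda>t. u + t *\<^sub>R d) has_derivative (\<lambda>s. s *\<^sub>R d)) (at t)"
      by (auto intro!: derivative_eq_intros)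
    from has_derivative_compose[OF this grad[unfolded gderiv_def]]
    have "((\<lambda>t. f (u + t *\<^sub>R d)) has_derivative (\<lambda>s. s *\<^sub>R d \<bullet> grad f (u + t *\<^sub>R d))) (at t)" .
    then show ?thesis
      unfolding has_field_derivative_def by (rule has_derivative_eq_rhs) (auto simp: inner_commute)
  qed
  have "f (u + 1 *\<^sub>R d) \<le> f (u + 0 *\<^sub>R d) + grad f (u + 0 *\<^sub>R d) \<bullet> d + l * (norm d)\<^sup>2 / 2"
  proof (rule descent_along_segment[OF deriv])
    fix t :: real assume t: "0 \<le> t"
    have "grad f (u + t *\<^sub>R d) \<bullet> d - grad f (u + 0 *\<^sub>R d) \<bullet> d
      = (block_part blk i (grad f (u + t *\<^sub>R d)) - block_part blk i (grad f u)) \<bullet> d"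
      using inner_block_part[of blk i _ d] by (simp add: dd inner_diff_left)
    also have "\<dots> \<le> norm (block_part blk i (grad f (u + t *\<^sub>R d)) - block_part blk i (grad f u)) * norm d"
      by (rule norm_cauchy_schwarz)
    also have "\<dots> \<le> (l * norm (t *\<^sub>R d)) * norm d"
      using smooth[of u "t *\<^sub>R d"] by (intro mult_right_mono) (simp_all add: dd)
    also have "\<dots> = l * (norm d)\<^sup>2 * t"
      using t by (simp add: power2_eq_square)
    finally show "grad f (u + t *\<^sub>R d) \<bullet> d - grad f (u + 0 *\<^sub>R d) \<bullet> d \<le> l * (norm d)\<^sup>2 * t" .
  qed
  then show ?thesis by (simp add: d_def)
qed

section \<open>Proximal steps\<close>

text \<open>Comparing \<open>p\<close> with \<open>(1 - t) *\<^sub>R p + t *\<^sub>R u\<close> and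
  dividing by \<open>t\<close> gives the claim with the gain scaled by \<open>1 - t\<close>. Letting
  \<open>t\<close> tend to 0 recovers the full gain without subgradients.\<close>

lemma prox_three_point:
  fixes w p u g :: "'a::real_inner"
  assumes conv: "convex_on S h" and p: "p \<in> S" and u: "u \<in> S"
    and min: "\<And>v. v \<in> S \<Longrightarrow> A * (norm (p - w))\<^sup>2 + g \<bullet> p + h p \<le> A * (norm (v - w))\<^sup>2 + g \<bullet> v + h v"
  shows "A * (norm (p - w))\<^sup>2 + g \<bullet> p + h p + A * (norm (u - p))\<^sup>2 \<le> A * (norm (u - w))\<^sup>2 + g \<bullet> u + h u"
proof -
  define \<phi> where "\<phi> v = A * (norm (v - w))\<^sup>2 + g \<bullet> v + h v" for v
  have bound: "\<phi> p + A * (1 - t) * (norm (u - p))\<^sup>2 \<le> \<phi> u" if t: "0 < t" "t < 1" for t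
  proof -
    define v where "v = (1 - t) *\<^sub>R p + t *\<^sub>R u"
    have "v \<in> S"
      using convex_on_imp_convex[OF conv] p u t by (simp add: v_def convex_alt)
    have hv: "h v \<le> (1 - t) * h p + t * h u"
      unfolding v_def using convex_onD[OF conv] p u t by simp
    have "v - w = (1 - t) *\<^sub>R (p - w) + t *\<^sub>R (u - w)"
      by (simp add: v_def algebra_simps)
    then have "(norm (v - w))\<^sup>2
        = (1 - t) * (norm (p - w))\<^sup>2 + t * (norm (u - w))\<^sup>2 - t * (1 - t) * (norm (u - p))\<^sup>2"
      by (simp add: norm_convex_combination_sq norm_minus_commute[of p u])
    moreover have "g \<bullet> v = (1 - t) * (g \<bullet> p) + t * (g \<bullet> u)"
      by (simp add: v_def inner_add_right)
    ultimately have "\<phi> v = A * ((1 - t) * (norm (p - w))\<^sup>2 + t * (norm (u - w))\<^sup>2 - t * (1 - t) * (norm (u - p))\<^sup>2)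
        + ((1 - t) * (g \<bullet> p) + t * (g \<bullet> u)) + h v"
      by (simp only: \<phi>_def)
    also have "\<dots> \<le> A * ((1 - t) * (norm (p - w))\<^sup>2 + t * (norm (u - w))\<^sup>2 - t * (1 - t) * (norm (u - p))\<^sup>2)
        + ((1 - t) * (g \<bullet> p) + t * (g \<bullet> u)) + ((1 - t) * h p + t * h u)"
      using hv by simp
    also have "\<dots> = (1 - t) * \<phi> p + t * \<phi> u - A * (t * (1 - t) * (norm (u - p))\<^sup>2)"
      by (simp add: \<phi>_def algebra_simps)
    finally have "\<phi> v \<le> (1 - t) * \<phi> p + t * \<phi> u - A * (t * (1 - t) * (norm (u - p))\<^sup>2)" .
    moreover have "\<phi> p \<le> \<phi> v"
      using min[OF \<open>v \<in> S\<close>] by (simp add: \<phi>_def)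
    ultimately have "t * (\<phi> p + A * (1 - t) * (norm (u - p))\<^sup>2) \<le> t * \<phi> u"
      by (simp add: algebra_simps)
    then show ?thesis using t by simp
  qed
  have "\<phi> p + A * (1 - 0) * (norm (u - p))\<^sup>2 \<le> \<phi> u"
  proof (rule tendsto_upperbound)
    show "((\<lambda>t. \<phi> p + A * (1 - t) * (norm (u - p))\<^sup>2) \<longlongrightarrow> \<phi> p + A * (1 - 0) * (norm (u - p))\<^sup>2) (at_right 0)"
      by (intro tendsto_intros)
    show "\<forall>\<^sub>F t in at_right 0. \<phi> p + A * (1 - t) * (norm (u - p))\<^sup>2 \<le> \<phi> u"
      unfolding eventually_at_right_field using bound by (intro exI[of _ 1]) auto
  qed simp
  then show ?thesis by (simp add: \<phi>_def)
qed

text \<open>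
  \<open>block_prox\<close> records that \<open>p\<close> minimises the strongly convex block subproblem: the last term on
  the left is the gain from strong convexity, and outside block \<open>i\<close> only the quadratic is left.
\<close>

definition block_prox ::
    "('N::finite \<Rightarrow> 'b::finite) \<Rightarrow> ('b \<Rightarrow> real) \<Rightarrow> (real ^ 'N) set \<Rightarrow> (real ^ 'N \<Rightarrow> real) \<Rightarrow> 'b \<Rightarrow>
     real \<Rightarrow> real ^ 'N \<Rightarrow> real ^ 'N \<Rightarrow> real ^ 'N \<Rightarrow> bool" where
  "block_prox blk L S h i A g w p \<longleftrightarrow>
     p \<in> S \<and> (\<forall>j. j \<noteq> i \<longrightarrow> block_part blk j p = block_part blk j w) \<and>
     (\<forall>u\<in>S. A * L i * (norm (block_part blk i p - block_part blk i w))\<^sup>2 + g \<bullet> block_part blk i p + h p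
            + A * L i * (norm (block_part blk i u - block_part blk i p))\<^sup>2
          \<le> A * L i * (norm (block_part blk i u - block_part blk i w))\<^sup>2 + g \<bullet> block_part blk i u + h u)"

text \<open>In block \<open>i\<close> each point competes against the other; adding the two
  inequalities, each with gain \<open>d\<close>, forces \<open>d = 0\<close>. Elsewhere both points
  agree with \<open>w\<close>.\<close>

lemma block_prox_unique:
  assumes p: "block_prox blk L S h i A g w p" and p': "block_prox blk L S h i A g w p'"
    and "0 < A" "0 < L i"
  shows "p = p'"
proof (rule block_part_eqI)
  fix j
  show "block_part blk j p = block_part blk j p'"
  proof (cases "j = i")
    case True
    define d where "d = A * L i * (norm (block_part blk i p - block_part blk i p'))\<^sup>2"
    have "d = A * L i * (norm (block_part blk i p' - block_part blk i p))\<^sup>2"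
      by (simp only: d_def norm_minus_commute)
    moreover have "p \<in> S" "p' \<in> S"
      using p p' by (auto simp: block_prox_def)
    ultimately have "d \<le> - d"
      using p p' unfolding block_prox_def d_def[symmetric] by (smt (verit) d_def)
    moreover have "0 \<le> d"
      using \<open>0 < A\<close> \<open>0 < L i\<close> by (simp add: d_def)
    ultimately have "d = 0" by linarith
    then show ?thesis
      using True \<open>0 < A\<close> \<open>0 < L i\<close> by (simp add: d_def)
  qed (use p p' in \<open>simp add: block_prox_def\<close>)
qed

section \<open>Finite values and block-wise convexity of the regularizer\<close>

locale separable_regularizer =
  fixes blk :: "'N::finite \<Rightarrow> 'b::finite" and \<Psi> :: "real ^ 'N \<Rightarrow> ereal"
    and \<Psi>s :: "'b \<Rightarrow> real ^ 'N \<Rightarrow> ereal" and x\<^sub>0 :: "real ^ 'N"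
  assumes Psi_convex: "ext_convex \<Psi>"
    and Psi_block: "\<And>i u. \<Psi>s i (block_part blk i u) \<noteq> -\<infinity>"
    and Psi_sep: "\<And>u. \<Psi> u = (\<Sum>i\<in>UNIV. \<Psi>s i (block_part blk i u))"
    and x0_dom: "x\<^sub>0 \<in> ext_dom \<Psi>"
begin

definition block_dom :: "'b \<Rightarrow> (real ^ 'N) set" where
  "block_dom i = {u. \<Psi>s i (block_part blk i u) < \<infinity>}"

text \<open>Meaningful on \<open>block_dom i\<close> only, since \<open>real_of_ereal\<close> sends
  infinity to 0.\<close>

definition block_val :: "'b \<Rightarrow> real ^ 'N \<Rightarrow> real" where
  "block_val i u = real_of_ereal (\<Psi>s i (block_part blk i u))"

definition val :: "real ^ 'N \<Rightarrow> real" where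
  "val u = (\<Sum>i\<in>UNIV. block_val i u)"

lemma block_dom_cong: "block_part blk i u = block_part blk i v \<Longrightarrow> u \<in> block_dom i \<longleftrightarrow> v \<in> block_dom i"
  and block_val_cong: "block_part blk i u = block_part blk i v \<Longrightarrow> block_val i u = block_val i v"
  by (simp_all add: block_dom_def block_val_def)

lemma Psis_eq: "u \<in> block_dom i \<Longrightarrow> \<Psi>s i (block_part blk i u) = ereal (block_val i u)"
  using Psi_block[of i u] by (cases "\<Psi>s i (block_part blk i u)") (auto simp: block_dom_def block_val_def)

lemma ext_dom_iff: "u \<in> ext_dom \<Psi> \<longleftrightarrow> (\<forall>i. u \<in> block_dom i)"
proof -
  have "\<Psi> u = \<infinity> \<longleftrightarrow> (\<exists>i. \<Psi>s i (block_part blk i u) = \<infinity>)"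
    unfolding Psi_sep by (simp add: sum_Pinfty)
  then show ?thesis
    by (auto simp: ext_dom_def block_dom_def less_top)
qed

lemma Psi_eq: "u \<in> ext_dom \<Psi> \<Longrightarrow> \<Psi> u = ereal (val u)"
  by (simp add: Psi_sep val_def Psis_eq ext_dom_iff)

lemma ext_dom_convex_comb:
  assumes "u \<in> ext_dom \<Psi>" "v \<in> ext_dom \<Psi>" "0 \<le> t" "t \<le> 1"
  shows "(1 - t) *\<^sub>R u + t *\<^sub>R v \<in> ext_dom \<Psi>"
    and "val ((1 - t) *\<^sub>R u + t *\<^sub>R v) \<le> (1 - t) * val u + t * val v"
proof -
  have le: "\<Psi> ((1 - t) *\<^sub>R u + t *\<^sub>R v) \<le> ereal ((1 - t) * val u + t * val v)"
  proof -
    have "\<Psi> ((1 - t) *\<^sub>R u + t *\<^sub>R v) \<le> ereal (1 - t) * \<Psi> u + ereal t * \<Psi> v"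
      using Psi_convex assms(3,4) by (simp add: ext_convex_def)
    then show ?thesis by (simp add: Psi_eq[OF assms(1)] Psi_eq[OF assms(2)])
  qed
  then show dom: "(1 - t) *\<^sub>R u + t *\<^sub>R v \<in> ext_dom \<Psi>"
    by (auto simp: ext_dom_def intro: le_less_trans)
  show "val ((1 - t) *\<^sub>R u + t *\<^sub>R v) \<le> (1 - t) * val u + t * val v"
    using le by (simp add: Psi_eq[OF dom])
qed

text \<open>Convexity is assumed for the sum over all blocks. Freezing the other blocks at the
  domain point \<open>x\<^sub>0\<close> turns \<open>val\<close> into \<open>block_val i\<close>
  plus a constant, and \<open>ext\<close> respects convex combinations.\<close>

lemma block_val_convex: "convex_on (block_dom i) (block_val i)"
proof -
  define ext where "ext u = x\<^sub>0 + block_part blk i (u - x\<^sub>0)" for u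
  have ext_i: "block_part blk i (ext u) = block_part blk i u" for u
    by (simp add: ext_def)
  have ext_j: "block_part blk j (ext u) = block_part blk j x\<^sub>0" if "j \<noteq> i" for u j
    using that by (simp add: ext_def)
  have ext_dom: "ext u \<in> ext_dom \<Psi> \<longleftrightarrow> u \<in> block_dom i" for u
  proof -
    have "ext u \<in> block_dom j \<longleftrightarrow> j \<noteq> i \<or> u \<in> block_dom i" for j
      using block_dom_cong[OF ext_i[of u]] block_dom_cong[OF ext_j[of j u]] x0_dom
      by (cases "j = i") (auto simp: ext_dom_iff)
    then show ?thesis by (auto simp: ext_dom_iff)
  qed
  have ext_val: "val (ext u) = block_val i u + (\<Sum>j\<in>UNIV - {i}. block_val j x\<^sub>0)" for u
  proof -
    have "val (ext u) = block_val i (ext u) + (\<Sum>j\<in>UNIV - {i}. block_val j (ext u))"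
      unfolding val_def by (rule sum.remove) auto
    also have "block_val i (ext u) = block_val i u"
      by (rule block_val_cong[OF ext_i])
    also have "(\<Sum>j\<in>UNIV - {i}. block_val j (ext u)) = (\<Sum>j\<in>UNIV - {i}. block_val j x\<^sub>0)"
      by (intro sum.cong refl block_val_cong ext_j) auto
    finally show ?thesis .
  qed
  have ext_comb: "ext ((1 - t) *\<^sub>R u + t *\<^sub>R v) = (1 - t) *\<^sub>R ext u + t *\<^sub>R ext v" for t u v
    by (simp add: ext_def algebra_simps)
  show ?thesis
  proof (rule convex_onI)
    fix t :: real and u v assume "0 < t" "t < 1" "u \<in> block_dom i" "v \<in> block_dom i"
    then have "val (ext ((1 - t) *\<^sub>R u + t *\<^sub>R v)) \<le> (1 - t) * val (ext u) + t * val (ext v)"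
      unfolding ext_comb by (intro ext_dom_convex_comb(2)) (auto simp: ext_dom)
    then show "block_val i ((1 - t) *\<^sub>R u + t *\<^sub>R v) \<le> (1 - t) * block_val i u + t * block_val i v"
      unfolding ext_val by (simp add: algebra_simps)
  next
    show "convex (block_dom i)"
      unfolding convex_alt
    proof (intro ballI allI impI)
      fix u v and t :: real assume "u \<in> block_dom i" "v \<in> block_dom i" "0 \<le> t \<and> t \<le> 1"
      then have "ext ((1 - t) *\<^sub>R u + t *\<^sub>R v) \<in> ext_dom \<Psi>"
        unfolding ext_comb by (intro ext_dom_convex_comb(1)) (auto simp: ext_dom)
      then show "(1 - t) *\<^sub>R u + t *\<^sub>R v \<in> block_dom i"
        by (simp only: ext_dom)
    qed
  qed
qed

text \<open>Replacing the other blocks of \<open>p\<close> by those of \<open>w\<close> cannot lower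
  the objective, so the quadratic vanishes there. What remains is a strongly convex problem in block
  \<open>i\<close> alone, to which \<open>prox_three_point\<close> applies.\<close>

lemma block_prox_of_arg_min:
  assumes L_pos: "\<And>i. 0 < L i" and A: "0 < A"
    and min: "is_arg_min
        (\<lambda>u. ereal (A * (block_norm blk L (u - w))\<^sup>2 + block_part blk i g \<bullet> block_part blk i u)
           + \<Psi>s i (block_part blk i u)) (\<lambda>u. u \<in> UNIV) p"
  shows "block_prox blk L (block_dom i) (block_val i) i A g w p"
proof -
  define Q where "Q u = A * (\<Sum>j\<in>UNIV. L j * (norm (block_part blk j u - block_part blk j w))\<^sup>2)
      + g \<bullet> block_part blk i u" for u
  have le: "ereal (Q p) + \<Psi>s i (block_part blk i p) \<le> ereal (Q u) + \<Psi>s i (block_part blk i u)" for u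
    using min unfolding is_arg_min_def block_norm_sq[of L, OF L_pos] inner_block_part Q_def block_part_diff
    by (simp add: not_less)
  have p_dom: "p \<in> block_dom i"
  proof -
    \<comment> \<open>The competitor \<open>x\<^sub>0\<close> has a finite objective, hence so has
      the minimiser.\<close>
    have "\<Psi>s i (block_part blk i x\<^sub>0) = ereal (block_val i x\<^sub>0)"
      using x0_dom by (simp add: ext_dom_iff Psis_eq)
    then have "\<Psi>s i (block_part blk i p) \<noteq> \<infinity>"
      using le[of x\<^sub>0] by auto
    then show ?thesis by (simp add: block_dom_def less_top)
  qed
  have le: "Q p + block_val i p \<le> Q u + block_val i u" if "u \<in> block_dom i" for u
    using le[of u] by (simp add: Psis_eq[OF that] Psis_eq[OF p_dom])
  have Q_remove: "Q u = A * (L i * (norm (block_part blk i u - block_part blk i w))\<^sup>2)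
      + A * (\<Sum>j\<in>UNIV - {i}. L j * (norm (block_part blk j u - block_part blk j w))\<^sup>2) + g \<bullet> block_part blk i u" for u
    unfolding Q_def by (simp add: sum.remove[of UNIV i] distrib_left)
  define paste where "paste u = w + block_part blk i (u - w)" for u
  have paste_i: "block_part blk i (paste u) = block_part blk i u" for u
    by (simp add: paste_def)
  have paste_j: "block_part blk j (paste u) = block_part blk j w" if "j \<noteq> i" for u j
    using that by (simp add: paste_def)
  have Q_paste: "Q (paste u) = A * (L i * (norm (block_part blk i u - block_part blk i w))\<^sup>2) + g \<bullet> block_part blk i u" for u
    unfolding Q_remove by (simp add: paste_i paste_j)
  have le_paste: "Q p + block_val i p \<le> Q (paste u) + block_val i u" if "u \<in> block_dom i" for u
    using le[of "paste u"] that
    by (simp add: block_dom_cong[OF paste_i] block_val_cong[OF paste_i])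

  have "A * (\<Sum>j\<in>UNIV - {i}. L j * (norm (block_part blk j p - block_part blk j w))\<^sup>2) \<le> 0"
    using le_paste[OF p_dom] unfolding Q_paste Q_remove[of p] by linarith
  then have "(\<Sum>j\<in>UNIV - {i}. L j * (norm (block_part blk j p - block_part blk j w))\<^sup>2) \<le> 0"
    using A by (simp add: mult_le_0_iff)
  then have sum0: "(\<Sum>j\<in>UNIV - {i}. L j * (norm (block_part blk j p - block_part blk j w))\<^sup>2) = 0"
    using L_pos by (intro antisym sum_nonneg) (auto simp: less_imp_le)
  then have others: "block_part blk j p = block_part blk j w" if "j \<noteq> i" for j
    using L_pos that by (subst (asm) sum_nonneg_eq_0_iff) (auto simp: less_imp_le less_imp_neq[THEN not_sym])

  \<comment> \<open>On vectors supported in block \<open>i\<close> the Euclidean norm is the norm of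
    the block, as \<open>prox_three_point\<close> expects.\<close>
  let ?S = "{v \<in> block_dom i. block_part blk i v = v}"
  have bp_S: "block_part blk i v \<in> ?S" if "v \<in> block_dom i" for v
    using that block_dom_cong[of i "block_part blk i v" v] by simp
  have bp_val: "block_val i (block_part blk i v) = block_val i v" for v
    by (rule block_val_cong) simp
  have conv: "convex_on ?S (block_val i)"
  proof (rule convex_on_subset[OF block_val_convex])
    have "convex (block_dom i)"
      by (rule convex_on_imp_convex[OF block_val_convex])
    then show "convex ?S"
      unfolding convex_alt by auto
  qed auto
  have "A * L i * (norm (block_part blk i p - block_part blk i w))\<^sup>2 + g \<bullet> block_part blk i p + block_val i p
            + A * L i * (norm (block_part blk i u - block_part blk i p))\<^sup>2
          \<le> A * L i * (norm (block_part blk i u - block_part blk i w))\<^sup>2 + g \<bullet> block_part blk i u + block_val i u"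
    if u: "u \<in> block_dom i" for u
  proof -
    have min: "A * L i * (norm (block_part blk i p - block_part blk i w))\<^sup>2 + g \<bullet> block_part blk i p + block_val i p
       \<le> A * L i * (norm (block_part blk i v - block_part blk i w))\<^sup>2 + g \<bullet> block_part blk i v + block_val i v"
      if "v \<in> block_dom i" for v
      using le_paste[OF that] unfolding Q_paste by (simp add: Q_remove sum0 mult.assoc)
    show ?thesis
      using prox_three_point[OF conv bp_S[OF p_dom] bp_S[OF u], of "A * L i" "block_part blk i w" g]
        min unfolding bp_val by force
  qed
  then show ?thesis
    unfolding block_prox_def using p_dom others by blast
qed

end

section \<open>One step of the method\<close>

text \<open>Column \<open>j\<close> is constant except in row \<open>j\<close>. Rows stand for the
  chosen block, columns for the summands of a separable function.\<close>

lemma sum_sum_diagonal: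
  fixes h :: "'b::finite \<Rightarrow> 'b \<Rightarrow> real"
  assumes "\<And>i j. j \<noteq> i \<Longrightarrow> h i j = c j"
  shows "(\<Sum>i\<in>UNIV. \<Sum>j\<in>UNIV. h i j) = (\<Sum>i\<in>UNIV. h i i) + (real CARD('b) - 1) * (\<Sum>j\<in>UNIV. c j)"
proof -
  have "(\<Sum>j\<in>UNIV. h i j) = h i i + (\<Sum>j\<in>UNIV. c j) - c i" for i
  proof -
    have "(\<Sum>j\<in>UNIV. h i j) = h i i + (\<Sum>j\<in>UNIV - {i}. h i j)"
      by (rule sum.remove) auto
    also have "(\<Sum>j\<in>UNIV - {i}. h i j) = (\<Sum>j\<in>UNIV - {i}. c j)"
      using assms by (intro sum.cong) auto
    also have "\<dots> = (\<Sum>j\<in>UNIV. c j) - c i"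
      by (simp add: sum_diff1)
    finally show ?thesis by simp
  qed
  then have "(\<Sum>i\<in>UNIV. \<Sum>j\<in>UNIV. h i j) = (\<Sum>i\<in>UNIV. h i i + (\<Sum>j\<in>UNIV. c j) - c i)"
    by (rule sum.cong[OF refl])
  then show ?thesis
    by (simp add: sum.distrib sum_subtractf algebra_simps)
qed

locale apcg_problem =
  separable_regularizer blk \<Psi> \<Psi>s x\<^sub>0 + apcg_parameters "CARD('b)" \<mu> \<gamma>\<^sub>0 \<alpha> \<beta> \<gamma>
  for blk :: "'N::finite \<Rightarrow> 'b::finite" and \<Psi> \<Psi>s x\<^sub>0 \<mu> \<gamma>\<^sub>0 \<alpha> \<beta> \<gamma> +
  fixes f :: "real ^ 'N \<Rightarrow> real" and L :: "'b \<Rightarrow> real"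
  assumes gderiv: "\<And>u. GDERIV f u :> grad f u"
    and L_pos: "\<And>i. 0 < L i"
    and smooth: "\<And>i u h.
          norm (block_part blk i (grad f (u + block_part blk i h)) - block_part blk i (grad f u))
            \<le> L i * norm (block_part blk i h)"
    and strong_convex: "\<And>u v. u \<in> ext_dom \<Psi> \<Longrightarrow>
          f v \<ge> f u + grad f u \<bullet> (v - u) + \<mu> / 2 * (block_norm blk L (v - u))\<^sup>2"
begin

abbreviation dist2 :: "real ^ 'N \<Rightarrow> real ^ 'N \<Rightarrow> real" where
  "dist2 u v \<equiv> (block_norm blk L (u - v))\<^sup>2"

abbreviation prox_step :: "'b \<Rightarrow> nat \<Rightarrow> real ^ 'N \<Rightarrow> real ^ 'N \<Rightarrow> real ^ 'N \<Rightarrow> bool" where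
  "prox_step i k y w p \<equiv>
     block_prox blk L (block_dom i) (block_val i) i (real CARD('b) * \<alpha> k / 2) (grad f y) w p"

lemma prox_step_in_dom:
  assumes "prox_step i k y w p" "w \<in> ext_dom \<Psi>"
  shows "p \<in> ext_dom \<Psi>"
  using assms block_dom_cong[of _ p w] unfolding block_prox_def ext_dom_iff by metis

text \<open>The displacement \<open>p - w\<close> lies in block \<open>i\<close>, so block descent
  applies. Since \<open>\<gamma> (Suc k) = b\<^sup>2\<close>, multiplying the three-point inequality
  by \<open>b\<close> matches its quadratic coefficient: the terms in \<open>X\<close> cancel, and
  those in \<open>Y\<close> and \<open>W\<close> form the change of the squared distance to
  \<open>u\<close>.\<close>

lemma prox_step_bound:
  assumes prox: "prox_step i k y w p"
    and x': "x' = y + (real CARD('b) * \<alpha> k) *\<^sub>R (p - w)"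
    and u: "u \<in> block_dom i"
  shows "f x' + \<gamma> (Suc k) / 2 * dist2 p u
    \<le> f y + real CARD('b) * \<alpha> k * (grad f y \<bullet> block_part blk i (u - w) + block_val i u - block_val i p)
        + \<gamma> (Suc k) / 2 * dist2 w u"
proof -
  define b where "b = real CARD('b) * \<alpha> k"
  define bp where "bp = block_part blk i"
  define X Y W where "X = (norm (bp p - bp w))\<^sup>2" and "Y = (norm (bp u - bp p))\<^sup>2"
    and "W = (norm (bp u - bp w))\<^sup>2"
  have "0 \<le> b"
    using alpha_pos[of k] by (simp add: b_def)
  have others: "block_part blk j p = block_part blk j w" if "j \<noteq> i" for j
    using prox that by (simp add: block_prox_def)
  have diff: "p - w = bp (p - w)"
  proof (rule block_part_eqI)
    show "block_part blk j (p - w) = block_part blk j (bp (p - w))" for j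
      using others[of j] by (cases "j = i") (simp_all add: bp_def)
  qed
  have x'_eq: "x' = y + bp (b *\<^sub>R (p - w))"
    using diff by (simp add: x' b_def bp_def)
  have "f x' \<le> f y + grad f y \<bullet> bp (b *\<^sub>R (p - w)) + L i / 2 * (norm (bp (b *\<^sub>R (p - w))))\<^sup>2"
    unfolding x'_eq bp_def by (rule block_descent[OF gderiv smooth])
  moreover have "grad f y \<bullet> bp (b *\<^sub>R (p - w)) = b * (grad f y \<bullet> bp p - grad f y \<bullet> bp w)"
    by (simp add: bp_def inner_diff_right)
  moreover have "(norm (bp (b *\<^sub>R (p - w))))\<^sup>2 = b\<^sup>2 * X"
    by (simp add: bp_def X_def power_mult_distrib flip: scaleR_diff_right)
  ultimately have descent: "f x' \<le> f y + b * (grad f y \<bullet> bp p - grad f y \<bullet> bp w) + L i / 2 * (b\<^sup>2 * X)"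
    by simp
  have "b / 2 * L i * X + grad f y \<bullet> bp p + block_val i p + b / 2 * L i * Y
      \<le> b / 2 * L i * W + grad f y \<bullet> bp u + block_val i u"
    using prox u unfolding block_prox_def X_def Y_def W_def b_def bp_def by blast
  from mult_left_mono[OF this \<open>0 \<le> b\<close>]
  have three: "L i / 2 * (b\<^sup>2 * X) + b * (grad f y \<bullet> bp p) + b * block_val i p + L i / 2 * (b\<^sup>2 * Y)
      \<le> L i / 2 * (b\<^sup>2 * W) + b * (grad f y \<bullet> bp u) + b * block_val i u"
    by (simp add: power2_eq_square algebra_simps)
  have "dist2 p u - dist2 w u = (\<Sum>j\<in>UNIV. if j = i then L i * (Y - W) else 0)"
    unfolding block_norm_sq[of L, OF L_pos] sum_subtractf[symmetric]
    by (intro sum.cong) (auto simp: others X_def Y_def W_def bp_def norm_minus_commute right_diff_distrib)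
  then have "dist2 p u = dist2 w u + L i * (Y - W)"
    by simp
  moreover have "\<gamma> (Suc k) = b\<^sup>2"
    by (simp only: gamma_Suc_sq b_def)
  ultimately have "\<gamma> (Suc k) / 2 * dist2 p u = \<gamma> (Suc k) / 2 * dist2 w u + L i / 2 * (b\<^sup>2 * Y) - L i / 2 * (b\<^sup>2 * W)"
    by (simp only:) (simp add: algebra_simps)
  moreover have "b * (grad f y \<bullet> bp (u - w) + block_val i u - block_val i p)
      = b * (grad f y \<bullet> bp u) - b * (grad f y \<bullet> bp w) + b * block_val i u - b * block_val i p"
    by (simp add: bp_def algebra_simps)
  moreover have "b * (grad f y \<bullet> bp p - grad f y \<bullet> bp w) = b * (grad f y \<bullet> bp p) - b * (grad f y \<bullet> bp w)"
    by (simp add: algebra_simps)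
  ultimately show ?thesis
    using descent three unfolding b_def[symmetric] bp_def[symmetric] by linarith
qed

text \<open>Convexity towards \<open>x\<close> is taken with weight \<open>1 - \<alpha> k\<close>,
  strong convexity towards \<open>u\<close> with weight \<open>\<alpha> k\<close>. The quadratic
  term of the latter pays for mixing \<open>y\<close> into \<open>w\<close>, because
  \<open>\<gamma> (Suc k) * \<beta> k = \<alpha> k * \<mu>\<close>.\<close>

lemma smooth_part_bound:
  assumes y: "y = (1 - \<tau> k) *\<^sub>R x + \<tau> k *\<^sub>R z" "y \<in> ext_dom \<Psi>"
    and w: "w = (1 - \<beta> k) *\<^sub>R z + \<beta> k *\<^sub>R y"
  shows "f y + \<alpha> k * (grad f y \<bullet> (u - w)) + \<gamma> (Suc k) / 2 * dist2 w u
    \<le> (1 - \<alpha> k) * (f x + \<gamma> k / 2 * dist2 z u) + \<alpha> k * f u"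
proof -
  have fx: "f y + grad f y \<bullet> (x - y) \<le> f x"
    using strong_convex[OF y(2), of x] mu_nonneg
    by (smt (verit) divide_nonneg_nonneg mult_nonneg_nonneg zero_le_power2)
  have fu: "f y + grad f y \<bullet> (u - y) + \<mu> / 2 * dist2 y u \<le> f u"
    using strong_convex[OF y(2), of u] by (simp add: block_norm_minus_commute)
  have "w - u = (1 - \<beta> k) *\<^sub>R (z - u) + \<beta> k *\<^sub>R (y - u)"
    by (simp add: w algebra_simps)
  then have "dist2 w u \<le> (1 - \<beta> k) * dist2 z u + \<beta> k * dist2 y u"
    using block_norm_sq_convex[of L "\<beta> k" blk "z - u" "y - u"] L_pos beta_nonneg beta_le_1 by metis
  then have "\<gamma> (Suc k) * dist2 w u \<le> \<gamma> (Suc k) * ((1 - \<beta> k) * dist2 z u + \<beta> k * dist2 y u)"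
    using gamma_pos[of "Suc k"] by (intro mult_left_mono) auto
  also have "\<dots> = (\<gamma> (Suc k) - \<gamma> (Suc k) * \<beta> k) * dist2 z u + \<gamma> (Suc k) * \<beta> k * dist2 y u"
    by (simp add: algebra_simps)
  also have "\<dots> = (1 - \<alpha> k) * \<gamma> k * dist2 z u + \<alpha> k * \<mu> * dist2 y u"
    unfolding gamma_beta by (simp add: gamma_Suc)
  finally have dist: "\<gamma> (Suc k) / 2 * dist2 w u \<le> (1 - \<alpha> k) * (\<gamma> k / 2 * dist2 z u) + \<alpha> k * (\<mu> / 2 * dist2 y u)"
    by simp
  \<comment> \<open>The coupling of \<open>\<tau>\<close> and \<open>\<beta>\<close> in
    \<open>alpha_beta_tau\<close> makes the linear term split with exactly these two
    weights.\<close>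
  have "\<alpha> k *\<^sub>R (u - w) = (1 - \<alpha> k) *\<^sub>R (x - y) + \<alpha> k *\<^sub>R (u - y)"
  proof -
    have "\<alpha> k *\<^sub>R (y - w) = (\<alpha> k * (1 - \<beta> k) * (1 - \<tau> k)) *\<^sub>R (x - z)"
      unfolding w by (simp add: y(1) algebra_simps)
    also have "\<dots> = (1 - \<alpha> k) *\<^sub>R (x - y)"
      unfolding alpha_beta_tau by (simp add: y(1) algebra_simps)
    finally show ?thesis
      by (simp add: algebra_simps)
  qed
  then have "\<alpha> k * (grad f y \<bullet> (u - w)) = (1 - \<alpha> k) * (grad f y \<bullet> (x - y)) + \<alpha> k * (grad f y \<bullet> (u - y))"
    by (metis inner_add_right inner_scaleR_right)
  moreover have "(1 - \<alpha> k) * (f y + grad f y \<bullet> (x - y)) \<le> (1 - \<alpha> k) * f x"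
    using fx alpha_le_1[of k] by (intro mult_left_mono) auto
  moreover have "\<alpha> k * (f y + grad f y \<bullet> (u - y) + \<mu> / 2 * dist2 y u) \<le> \<alpha> k * f u"
    using fu alpha_pos[of k] by (intro mult_left_mono) auto
  moreover have "f y = (1 - \<alpha> k) * f y + \<alpha> k * f y"
    by (simp add: algebra_simps)
  ultimately show ?thesis
    using dist unfolding distrib_left by linarith
qed

text \<open>Summation reassembles the block inner products. The values
  \<open>block_val i (p i)\<close> stay explicit, as they cancel in \<open>potential_step\<close>
  against part of the sum of \<open>val (p i)\<close>.\<close>

lemma sum_smooth_part_bound:
  assumes y: "y = (1 - \<tau> k) *\<^sub>R x + \<tau> k *\<^sub>R z" "y \<in> ext_dom \<Psi>"
    and w: "w = (1 - \<beta> k) *\<^sub>R z + \<beta> k *\<^sub>R y"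
    and prox: "\<And>i. prox_step i k y w (p i)"
    and x': "\<And>i. x' i = y + (real CARD('b) * \<alpha> k) *\<^sub>R (p i - w)"
    and u: "u \<in> ext_dom \<Psi>"
  shows "(\<Sum>i\<in>UNIV. f (x' i) + \<gamma> (Suc k) / 2 * dist2 (p i) u)
    \<le> real CARD('b) * ((1 - \<alpha> k) * (f x + \<gamma> k / 2 * dist2 z u) + \<alpha> k * (f u + val u)
        - \<alpha> k * (\<Sum>i\<in>UNIV. block_val i (p i)))"
proof -
  have "(\<Sum>i\<in>UNIV. f (x' i) + \<gamma> (Suc k) / 2 * dist2 (p i) u)
    \<le> (\<Sum>i\<in>UNIV. f y + real CARD('b) * \<alpha> k * (grad f y \<bullet> block_part blk i (u - w) + block_val i u - block_val i (p i))
        + \<gamma> (Suc k) / 2 * dist2 w u)"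
    using u by (intro sum_mono prox_step_bound[OF prox x']) (simp add: ext_dom_iff)
  also have "\<dots> = real CARD('b) * ((f y + \<alpha> k * (grad f y \<bullet> (u - w)) + \<gamma> (Suc k) / 2 * dist2 w u)
      + \<alpha> k * (val u - (\<Sum>i\<in>UNIV. block_val i (p i))))"
  proof -
    have "(\<Sum>i\<in>UNIV. grad f y \<bullet> block_part blk i (u - w) + block_val i u - block_val i (p i))
      = grad f y \<bullet> (u - w) + val u - (\<Sum>i\<in>UNIV. block_val i (p i))"
      by (simp only: sum.distrib sum_subtractf val_def sum_inner_block_part)
    then show ?thesis
      by (simp only: sum.distrib sum_distrib_left[symmetric]) (simp add: algebra_simps)
  qed
  also have "\<dots> \<le> real CARD('b) * (((1 - \<alpha> k) * (f x + \<gamma> k / 2 * dist2 z u) + \<alpha> k * f u)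
      + \<alpha> k * (val u - (\<Sum>i\<in>UNIV. block_val i (p i))))"
    by (intro mult_left_mono add_right_mono smooth_part_bound[OF y w]) auto
  finally show ?thesis
    by (simp add: algebra_simps)
qed

lemma sum_val_prox:
  assumes "\<And>i. prox_step i k y w (p i)"
  shows "(\<Sum>i\<in>UNIV. val (p i)) = (\<Sum>i\<in>UNIV. block_val i (p i)) + (real CARD('b) - 1) * val w"
  unfolding val_def
proof (rule sum_sum_diagonal)
  fix i j :: 'b assume "j \<noteq> i"
  then show "block_val j (p i) = block_val j w"
    using assms[of i] by (intro block_val_cong) (simp add: block_prox_def)
qed

end

context apcg_problem
begin

section \<open>Runs of the method\<close>

text \<open>
  \<open>carried z k\<close> is the contribution of \<open>z 0, \<dots>, z (k - 1)\<close> to \<open>x k\<close>; \<open>carried_val\<close> takes the same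
  combination of the values of \<open>\<Psi>\<close>.
\<close>

primrec carried :: "(nat \<Rightarrow> real ^ 'N) \<Rightarrow> nat \<Rightarrow> real ^ 'N" where
  "carried z 0 = 0"
| "carried z (Suc k) = \<sigma> k *\<^sub>R carried z k + \<kappa> k *\<^sub>R z k"

primrec carried_val :: "(nat \<Rightarrow> real ^ 'N) \<Rightarrow> nat \<Rightarrow> real" where
  "carried_val z 0 = 0"
| "carried_val z (Suc k) = \<sigma> k * carried_val z k + \<kappa> k * val (z k)"

text \<open>The regularizer enters through \<open>P k\<close> because this is affine in
  \<open>val (z (Suc k))\<close> at the next step, so its average over the chosen block can be
  computed exactly.\<close>

definition potential :: "(nat \<Rightarrow> real ^ 'N) \<Rightarrow> (nat \<Rightarrow> real ^ 'N) \<Rightarrow> real ^ 'N \<Rightarrow> nat \<Rightarrow> real" where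
  "potential x z u k =
     f (x k) + (carried_val z k + \<theta> k * val (z k)) - (f u + val u) + \<gamma> k / 2 * dist2 (z k) u"

abbreviation run :: "(nat \<Rightarrow> 'b) \<Rightarrow> (nat \<Rightarrow> real ^ 'N) \<Rightarrow> (nat \<Rightarrow> real ^ 'N) \<Rightarrow> (nat \<Rightarrow> real ^ 'N) \<Rightarrow> bool" where
  "run \<equiv> apcg_run blk f \<Psi>s L \<mu> \<alpha> \<beta> \<gamma> x\<^sub>0"

abbreviation mixed :: "(nat \<Rightarrow> real ^ 'N) \<Rightarrow> (nat \<Rightarrow> real ^ 'N) \<Rightarrow> nat \<Rightarrow> real ^ 'N" where
  "mixed y z k \<equiv> (1 - \<beta> k) *\<^sub>R z k + \<beta> k *\<^sub>R y k"

lemma run_0: "run idx x y z \<Longrightarrow> x 0 = x\<^sub>0" "run idx x y z \<Longrightarrow> z 0 = x\<^sub>0"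
  by (simp_all add: apcg_run_def)

lemma run_y:
  assumes "run idx x y z"
  shows "y k = (1 - \<tau> k) *\<^sub>R x k + \<tau> k *\<^sub>R z k"
proof -
  have "y k = (1 / (\<alpha> k * \<gamma> k + \<gamma> (Suc k))) *\<^sub>R ((\<alpha> k * \<gamma> k) *\<^sub>R z k + \<gamma> (Suc k) *\<^sub>R x k)"
    using assms by (simp add: apcg_run_def)
  also have "\<dots> = (1 - \<tau> k) *\<^sub>R x k + \<tau> k *\<^sub>R z k"
    unfolding one_minus_tau by (simp add: \<tau>_def scaleR_add_right)
  finally show ?thesis .
qed

lemma run_prox:
  assumes "run idx x y z"
  shows "prox_step (idx k) k (y k) (mixed y z k) (z (Suc k))"
proof -
  have "is_arg_min
          (\<lambda>u. ereal (real CARD('b) * \<alpha> k / 2 * (block_norm blk L (u - mixed y z k))\<^sup>2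
                + block_part blk (idx k) (grad f (y k)) \<bullet> block_part blk (idx k) u)
                + \<Psi>s (idx k) (block_part blk (idx k) u))
          (\<lambda>u. u \<in> UNIV) (z (Suc k))"
    using assms unfolding apcg_run_def diff_diff_add by blast
  then show ?thesis
    using alpha_pos[of k] by (intro block_prox_of_arg_min L_pos) auto
qed

text \<open>By \<open>n_alpha_beta\<close> the correction term equals \<open>n * \<alpha> k\<close>
  times \<open>z k\<close> minus the proximal centre. The step from \<open>y k\<close> is thus a
  multiple of a displacement in the chosen block, as block descent requires.\<close>

lemma run_x:
  assumes "run idx x y z"
  shows "x (Suc k) = y k + (real CARD('b) * \<alpha> k) *\<^sub>R (z (Suc k) - mixed y z k)"
proof -
  have "(real CARD('b) * \<alpha> k) *\<^sub>R (z k - mixed y z k) = (real CARD('b) * \<alpha> k * \<beta> k) *\<^sub>R (z k - y k)"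
    by (simp add: algebra_simps)
  then have "(\<mu> / real CARD('b)) *\<^sub>R (z k - y k) = (real CARD('b) * \<alpha> k) *\<^sub>R (z k - mixed y z k)"
    by (simp only: n_alpha_beta)
  moreover have "x (Suc k) = y k + (real CARD('b) * \<alpha> k) *\<^sub>R (z (Suc k) - z k)
                        + (\<mu> / real CARD('b)) *\<^sub>R (z k - y k)"
    using assms by (simp add: apcg_run_def)
  ultimately have "x (Suc k) = y k + ((real CARD('b) * \<alpha> k) *\<^sub>R (z (Suc k) - z k)
      + (real CARD('b) * \<alpha> k) *\<^sub>R (z k - mixed y z k))"
    by (simp only: add.assoc)
  then show ?thesis
    by (simp only: scaleR_add_right[symmetric]) simp
qed

text \<open>The hypothesis holds for every final point, so it can be applied to a normalised mixture
  of \<open>z k\<close> and the new point. No individual weights have to be tracked.\<close>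

lemma carried_step:
  assumes IH: "\<And>u. u \<in> ext_dom \<Psi> \<Longrightarrow> carried z k + \<theta> k *\<^sub>R u \<in> ext_dom \<Psi> \<and>
            val (carried z k + \<theta> k *\<^sub>R u) \<le> carried_val z k + \<theta> k * val u"
    and z: "z k \<in> ext_dom \<Psi>" and u: "u \<in> ext_dom \<Psi>"
  shows "carried z (Suc k) + \<theta> (Suc k) *\<^sub>R u \<in> ext_dom \<Psi>"
    and "val (carried z (Suc k) + \<theta> (Suc k) *\<^sub>R u) \<le> carried_val z (Suc k) + \<theta> (Suc k) * val u"
proof -
  define b where "b = real CARD('b) * \<alpha> k"
  \<comment> \<open>The joint weight of \<open>z k\<close> and the new point. A portion
    \<open>\<sigma> k * \<theta> k\<close> of it completes the old combination; the rest is
    \<open>1 - \<sigma> k\<close>.\<close>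
  define m where "m = \<kappa> k + b"
  have "0 < b"
    using alpha_pos[of k] by (simp add: b_def)
  then have "0 < m" and b: "0 \<le> b / m" "b / m \<le> 1" and kap: "1 - b / m = \<kappa> k / m"
    using kappa_nonneg[of k] by (auto simp: m_def field_simps)
  have m_eq: "m = \<sigma> k * \<theta> k + (1 - \<sigma> k)"
    using weights_sum[of k] by (simp add: m_def b_def algebra_simps)
  define v where "v = (1 - b / m) *\<^sub>R z k + (b / m) *\<^sub>R u"
  have v: "v \<in> ext_dom \<Psi>" "val v \<le> (1 - b / m) * val (z k) + b / m * val u"
    unfolding v_def using ext_dom_convex_comb[OF z u b] by auto
  have mv: "m *\<^sub>R v = \<kappa> k *\<^sub>R z k + b *\<^sub>R u"
    using \<open>0 < m\<close> unfolding v_def kap by (simp add: scaleR_add_right)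
  have "carried z (Suc k) + \<theta> (Suc k) *\<^sub>R u = \<sigma> k *\<^sub>R carried z k + m *\<^sub>R v"
    by (simp add: mv b_def)
  also have "\<dots> = (1 - (1 - \<sigma> k)) *\<^sub>R (carried z k + \<theta> k *\<^sub>R v) + (1 - \<sigma> k) *\<^sub>R v"
    unfolding m_eq by (simp add: algebra_simps)
  finally have split: "carried z (Suc k) + \<theta> (Suc k) *\<^sub>R u
      = (1 - (1 - \<sigma> k)) *\<^sub>R (carried z k + \<theta> k *\<^sub>R v) + (1 - \<sigma> k) *\<^sub>R v" .
  have comb: "0 \<le> 1 - \<sigma> k" "1 - \<sigma> k \<le> 1"
    using sigma_bounds[of k] by auto
  show "carried z (Suc k) + \<theta> (Suc k) *\<^sub>R u \<in> ext_dom \<Psi>"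
    unfolding split using IH[OF v(1)] v(1) comb by (intro ext_dom_convex_comb(1)) auto
  have "val (carried z (Suc k) + \<theta> (Suc k) *\<^sub>R u)
      \<le> (1 - (1 - \<sigma> k)) * val (carried z k + \<theta> k *\<^sub>R v) + (1 - \<sigma> k) * val v"
    unfolding split using IH[OF v(1)] v(1) comb by (intro ext_dom_convex_comb(2)) auto
  also have "\<dots> \<le> \<sigma> k * (carried_val z k + \<theta> k * val v) + (1 - \<sigma> k) * val v"
    using IH[OF v(1)] sigma_bounds[of k] by (simp add: mult_left_mono)
  also have "\<dots> = \<sigma> k * carried_val z k + m * val v"
    unfolding m_eq by (simp add: algebra_simps)
  also have "\<dots> \<le> \<sigma> k * carried_val z k + m * ((1 - b / m) * val (z k) + b / m * val u)"
    using v(2) \<open>0 < m\<close> by simp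
  also have "m * ((1 - b / m) * val (z k) + b / m * val u) = \<kappa> k * val (z k) + b * val u"
    using \<open>0 < m\<close> unfolding kap by (simp add: distrib_left)
  finally show "val (carried z (Suc k) + \<theta> (Suc k) *\<^sub>R u) \<le> carried_val z (Suc k) + \<theta> (Suc k) * val u"
    by (simp add: b_def)
qed

text \<open>The quantification over \<open>u\<close> strengthens the induction; the instance
  \<open>u = z k\<close> gives \<open>x k\<close> in the domain and its value at most
  \<open>P k\<close>.\<close>

lemma run_invariant:
  assumes run: "run idx x y z"
  shows "x k = carried z k + \<theta> k *\<^sub>R z k \<and> z k \<in> ext_dom \<Psi> \<and>
    (\<forall>u\<in>ext_dom \<Psi>. carried z k + \<theta> k *\<^sub>R u \<in> ext_dom \<Psi> \<and>
       val (carried z k + \<theta> k *\<^sub>R u) \<le> carried_val z k + \<theta> k * val u)"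
proof (induction k)
  case 0
  then show ?case by (simp add: run_0[OF run] x0_dom)
next
  case (Suc k)
  then have xk: "x k = carried z k + \<theta> k *\<^sub>R z k" and zk: "z k \<in> ext_dom \<Psi>"
    and IH: "\<And>u. u \<in> ext_dom \<Psi> \<Longrightarrow> carried z k + \<theta> k *\<^sub>R u \<in> ext_dom \<Psi> \<and>
       val (carried z k + \<theta> k *\<^sub>R u) \<le> carried_val z k + \<theta> k * val u"
    by auto
  have "x k \<in> ext_dom \<Psi>"
    unfolding xk using IH[OF zk] by blast
  then have "y k \<in> ext_dom \<Psi>"
    unfolding run_y[OF run] using zk tau_bounds by (intro ext_dom_convex_comb(1)) auto
  then have "mixed y z k \<in> ext_dom \<Psi>"
    using zk beta_nonneg beta_le_1 by (intro ext_dom_convex_comb(1)) auto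
  then have "z (Suc k) \<in> ext_dom \<Psi>"
    by (rule prox_step_in_dom[OF run_prox[OF run]])
  moreover have "x (Suc k) = carried z (Suc k) + \<theta> (Suc k) *\<^sub>R z (Suc k)"
  proof -
    define b where "b = real CARD('b) * \<alpha> k"
    \<comment> \<open>This computation is the origin of \<open>\<sigma>\<close> and
      \<open>\<kappa>\<close>: they are the coefficients of \<open>carried z k\<close> and
      \<open>z k\<close>.\<close>
    have "y k - b *\<^sub>R mixed y z k = (1 - b * \<beta> k) *\<^sub>R y k - (b * (1 - \<beta> k)) *\<^sub>R z k"
      by (simp add: algebra_simps)
    also have "\<dots> = (1 - \<mu> / real CARD('b)) *\<^sub>R ((1 - \<tau> k) *\<^sub>R (carried z k + \<theta> k *\<^sub>R z k) + \<tau> k *\<^sub>R z k)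
        - (b * (1 - \<beta> k)) *\<^sub>R z k"
      by (simp only: b_def n_alpha_beta run_y[OF run] xk)
    also have "\<dots> = carried z (Suc k)"
      by (simp add: \<sigma>_def \<kappa>_def b_def algebra_simps)
    finally have "y k - b *\<^sub>R mixed y z k = carried z (Suc k)" .
    then show ?thesis
      unfolding run_x[OF run] b_def[symmetric] by (simp add: b_def algebra_simps)
  qed
  ultimately show ?case
    using carried_step[OF IH zk] by blast
qed

lemma run_in_dom:
  assumes run: "run idx x y z"
  shows "x k \<in> ext_dom \<Psi>" "y k \<in> ext_dom \<Psi>" "z k \<in> ext_dom \<Psi>" "mixed y z k \<in> ext_dom \<Psi>"
proof -
  show z: "z k \<in> ext_dom \<Psi>" and x: "x k \<in> ext_dom \<Psi>"
    using run_invariant[OF run, of k] by auto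
  show y: "y k \<in> ext_dom \<Psi>"
    unfolding run_y[OF run] using x z tau_bounds by (intro ext_dom_convex_comb(1)) auto
  show "mixed y z k \<in> ext_dom \<Psi>"
    using y z beta_nonneg beta_le_1 by (intro ext_dom_convex_comb(1)) auto
qed

lemma run_val_le:
  assumes "run idx x y z"
  shows "val (x k) \<le> carried_val z k + \<theta> k * val (z k)"
  using run_invariant[OF assms, of k] by auto

lemma run_val_mixed_le:
  assumes run: "run idx x y z"
  shows "val (mixed y z k)
    \<le> (1 - \<beta> k + \<beta> k * \<tau> k) * val (z k) + \<beta> k * (1 - \<tau> k) * (carried_val z k + \<theta> k * val (z k))"
proof -
  have "val (y k) \<le> (1 - \<tau> k) * val (x k) + \<tau> k * val (z k)"
    unfolding run_y[OF run] using run_in_dom[OF run] tau_bounds by (intro ext_dom_convex_comb(2)) auto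
  also have "\<dots> \<le> (1 - \<tau> k) * (carried_val z k + \<theta> k * val (z k)) + \<tau> k * val (z k)"
    using run_val_le[OF run] tau_bounds by (intro add_right_mono mult_left_mono) auto
  finally have y: "val (y k) \<le> (1 - \<tau> k) * (carried_val z k + \<theta> k * val (z k)) + \<tau> k * val (z k)" .
  have "val (mixed y z k) \<le> (1 - \<beta> k) * val (z k) + \<beta> k * val (y k)"
    using run_in_dom[OF run] beta_nonneg beta_le_1 by (intro ext_dom_convex_comb(2)) auto
  also have "\<dots> \<le> (1 - \<beta> k) * val (z k)
      + \<beta> k * ((1 - \<tau> k) * (carried_val z k + \<theta> k * val (z k)) + \<tau> k * val (z k))"
    using y beta_nonneg by (intro add_left_mono mult_left_mono) auto
  finally show ?thesis
    by (simp add: algebra_simps)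
qed

text \<open>The next state depends only on the current one and the chosen block, since proximal
  points are unique. Choices from time \<open>k\<close> on do not influence \<open>x k\<close> and
  \<open>z k\<close>.\<close>

lemma run_determined:
  assumes r1: "run idx x y z" and r2: "run idx' x' y' z'"
    and "\<And>j. j < k \<Longrightarrow> idx j = idx' j"
  shows "x k = x' k \<and> z k = z' k"
  using assms(3)
proof (induction k)
  case 0
  then show ?case using run_0[OF r1] run_0[OF r2] by simp
next
  case (Suc k)
  then have xz: "x k = x' k" "z k = z' k" and i: "idx k = idx' k"
    by auto
  then have y: "y k = y' k"
    using run_y[OF r1, of k] run_y[OF r2, of k] by simp
  have "z (Suc k) = z' (Suc k)"
  proof (rule block_prox_unique)
    show "prox_step (idx k) k (y k) (mixed y z k) (z (Suc k))"
      by (rule run_prox[OF r1])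
    show "prox_step (idx k) k (y k) (mixed y z k) (z' (Suc k))"
      using run_prox[OF r2, of k] by (simp only: xz y i)
  qed (use alpha_pos L_pos in auto)
  then show ?case
    using run_x[OF r1, of k] run_x[OF r2, of k] xz y by simp
qed

lemma carried_val_cong:
  assumes "\<And>j. j < k \<Longrightarrow> z j = z' j"
  shows "carried_val z k = carried_val z' k"
  using assms by (induction k) auto

lemma run_potential_cong:
  assumes "run idx x y z" "run idx' x' y' z'" "\<And>j. j < k \<Longrightarrow> idx j = idx' j"
  shows "potential x z u k = potential x' z' u k"
proof -
  have "x j = x' j \<and> z j = z' j" if "j \<le> k" for j
    using run_determined[OF assms(1,2), of j] assms(3) that by auto
  then have "x k = x' k" "z k = z' k" and "carried_val z k = carried_val z' k"
    by (auto intro: carried_val_cong)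
  then show ?thesis by (simp add: potential_def)
qed

text \<open>The runs share the history before time \<open>k\<close>, and run \<open>i\<close> then
  chooses block \<open>i\<close>; dividing by the number of blocks turns the sum into a conditional
  expectation.\<close>

lemma potential_step:
  assumes runs: "\<And>i. run (idx i) (x i) (y i) (z i)"
    and same: "\<And>i j. j < k \<Longrightarrow> idx i j = idx' j" and run': "run idx' x' y' z'"
    and all: "\<And>i. idx i k = i"
    and u: "u \<in> ext_dom \<Psi>"
  shows "(\<Sum>i\<in>UNIV. potential (x i) (z i) u (Suc k)) \<le> real CARD('b) * ((1 - \<alpha> k) * potential x' z' u k)"
proof -
  define n where "n = real CARD('b)"
  define Q where "Q = carried_val z' k"
  define H where "H = Q + \<theta> k * val (z' k)"
  define Fu where "Fu = f u + val u"
  define D where "D = f (x' k) + \<gamma> k / 2 * dist2 (z' k) u"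
  define S where "S = (\<Sum>i\<in>UNIV. block_val i (z i (Suc k)))"
  have "1 \<le> n"
    by (simp add: n_def Suc_leI)
  have state: "x i j = x' j" "z i j = z' j" if "j \<le> k" for i j
    using run_determined[OF runs run', of j i] same that by auto
  have y: "y i k = y' k" for i
    using run_y[OF runs, of i k] run_y[OF run', of k] state[of k i] by simp
  have prox: "prox_step i k (y' k) (mixed y' z' k) (z i (Suc k))" for i
    using run_prox[OF runs, of i k] unfolding all y state(2)[OF order_refl] .
  have xS: "x i (Suc k) = y' k + (real CARD('b) * \<alpha> k) *\<^sub>R (z i (Suc k) - mixed y' z' k)" for i
    using run_x[OF runs, of i k] unfolding y state(2)[OF order_refl] .
  have Q: "carried_val (z i) k = Q" for i
    unfolding Q_def by (rule carried_val_cong) (simp add: state)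
  have smooth: "(\<Sum>i\<in>UNIV. f (x i (Suc k)) + \<gamma> (Suc k) / 2 * dist2 (z i (Suc k)) u)
      \<le> n * ((1 - \<alpha> k) * D + \<alpha> k * Fu - \<alpha> k * S)"
    unfolding n_def D_def Fu_def S_def
    by (rule sum_smooth_part_bound[OF run_y[OF run'] run_in_dom(2)[OF run'] refl prox xS u])
  have val: "(\<Sum>i\<in>UNIV. val (z i (Suc k))) = S + (n - 1) * val (mixed y' z' k)"
    unfolding S_def n_def by (rule sum_val_prox[OF prox])
  have "potential (x i) (z i) u (Suc k)
      = (f (x i (Suc k)) + \<gamma> (Suc k) / 2 * dist2 (z i (Suc k)) u)
        + (\<sigma> k * Q + \<kappa> k * val (z' k) - Fu) + n * \<alpha> k * val (z i (Suc k))" for i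
    using state[of k i] Q[of i] by (simp add: potential_def Fu_def n_def)
  then have "(\<Sum>i\<in>UNIV. potential (x i) (z i) u (Suc k))
      = (\<Sum>i\<in>UNIV. f (x i (Suc k)) + \<gamma> (Suc k) / 2 * dist2 (z i (Suc k)) u)
        + n * (\<sigma> k * Q + \<kappa> k * val (z' k) - Fu) + n * \<alpha> k * (S + (n - 1) * val (mixed y' z' k))"
    by (simp only: sum.distrib sum_distrib_left[symmetric] val) (simp add: n_def)
  also have "\<dots> \<le> n * ((1 - \<alpha> k) * D + \<alpha> k * Fu - \<alpha> k * S)
      + n * (\<sigma> k * Q + \<kappa> k * val (z' k) - Fu)
      + n * \<alpha> k * (S + (n - 1) * ((1 - \<beta> k + \<beta> k * \<tau> k) * val (z' k) + \<beta> k * (1 - \<tau> k) * H))"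
    using smooth run_val_mixed_le[OF run', of k] \<open>1 \<le> n\<close> alpha_pos[of k]
    unfolding H_def Q_def by (intro add_mono mult_left_mono order_refl) auto
  \<comment> \<open>The terms with \<open>S\<close> cancel; the rest is sorted to expose the left
    sides of the two expected-weight identities.\<close>
  also have "\<dots> = n * ((1 - \<alpha> k) * (D - Fu)
      + (\<kappa> k - \<sigma> k * \<theta> k + (n - 1) * (\<alpha> k * (1 - \<beta> k + \<beta> k * \<tau> k))) * val (z' k)
      + (\<sigma> k + (n - 1) * (\<alpha> k * (\<beta> k * (1 - \<tau> k)))) * H)"
    unfolding H_def by (simp add: algebra_simps)
  also have "\<dots> = n * ((1 - \<alpha> k) * (D - Fu + H))"
    unfolding n_def expected_weight_prev expected_weight_current by (simp add: algebra_simps)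
  also have "D - Fu + H = potential x' z' u k"
    by (simp add: potential_def D_def Fu_def H_def Q_def)
  finally show ?thesis
    by (simp add: n_def)
qed

end

section \<open>Expectation over the random blocks\<close>

lemma lists_length_Suc_sum:
  fixes G :: "'b::finite list \<Rightarrow> real"
  shows "(\<Sum>l | length l = Suc k. G l) = (\<Sum>l | length l = k. \<Sum>i\<in>UNIV. G (l @ [i]))"
proof -
  have "{l :: 'b list. length l = Suc k} = (\<lambda>(l, i). l @ [i]) ` ({l. length l = k} \<times> UNIV)"
  proof (intro equalityI subsetI)
    fix l :: "'b list" assume "l \<in> {l. length l = Suc k}"
    then have "l = butlast l @ [last l]" "length (butlast l) = k"
      by (auto intro: append_butlast_last_id[symmetric])
    then show "l \<in> (\<lambda>(l, i). l @ [i]) ` ({l. length l = k} \<times> UNIV)"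
      by (intro image_eqI[of _ _ "(butlast l, last l)"]) auto
  qed auto
  moreover have "inj_on (\<lambda>(l, i). l @ [i]) ({l :: 'b list. length l = k} \<times> UNIV)"
    by (auto simp: inj_on_def)
  ultimately have "(\<Sum>l | length l = Suc k. G l) = (\<Sum>(l, i)\<in>{l. length l = k} \<times> UNIV. G (l @ [i]))"
    by (simp add: sum.reindex case_prod_unfold)
  then show ?thesis
    by (simp add: sum.cartesian_product)
qed

locale uniform_choices = prob_space M for M :: "'w measure" +
  fixes idx :: "nat \<Rightarrow> 'w \<Rightarrow> 'b::finite"
  assumes idx_indep: "indep_vars (\<lambda>_. count_space UNIV) idx UNIV"
    and idx_uniform: "\<And>j i. prob {w \<in> space M. idx j w = i} = 1 / real CARD('b)"
begin

definition hist :: "nat \<Rightarrow> 'w \<Rightarrow> 'b list" where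
  "hist k w = map (\<lambda>j. idx j w) [0..<k]"

lemma length_hist [simp]: "length (hist k w) = k"
  by (simp add: hist_def)

lemma hist_Suc: "hist (Suc k) w = hist k w @ [idx k w]"
  by (simp add: hist_def)

lemma hist_eq_iff: "hist k w = hist k w' \<longleftrightarrow> (\<forall>j<k. idx j w = idx j w')"
  by (auto simp: hist_def)

lemma hist_event:
  assumes "length l = k"
  shows "{w \<in> space M. hist k w = l} \<in> sets M"
    and "prob {w \<in> space M. hist k w = l} = (1 / real CARD('b)) ^ k"
proof -
  \<comment> \<open>The factor \<open>space M\<close> keeps the formula correct for
    \<open>k = 0\<close>, where the indexed intersection is \<open>UNIV\<close>.\<close>
  have eq: "{w \<in> space M. hist k w = l} = space M \<inter> (\<Inter>j\<in>{..<k}. idx j -` {l ! j} \<inter> space M)"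
    using assms by (auto simp: hist_def list_eq_iff_nth_eq)
  have "idx j \<in> measurable M (count_space UNIV)" for j
    using idx_indep unfolding indep_vars_def by auto
  then have "idx j -` {i} \<inter> space M \<in> sets M" for i j
    by (rule measurable_sets) auto
  then show "{w \<in> space M. hist k w = l} \<in> sets M"
    unfolding eq by (cases "k = 0") (simp, rule sets.Int[OF sets.top sets.finite_INT], auto)
  show "prob {w \<in> space M. hist k w = l} = (1 / real CARD('b)) ^ k"
  \<comment> \<open>The product rule for independent variables is stated for nonempty index
    sets.\<close>
  proof (cases "k = 0")
    case True
    then show ?thesis using assms by (simp add: hist_def prob_space)
  next
    case False
    then have "prob {w \<in> space M. hist k w = l} = prob (\<Inter>j\<in>{..<k}. idx j -` {l ! j} \<inter> space M)"
      unfolding eq by (intro arg_cong[of _ _ prob]) auto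
    also have "\<dots> = (\<Prod>j\<in>{..<k}. prob (idx j -` {l ! j} \<inter> space M))"
      using False by (intro indep_varsD[OF idx_indep]) auto
    also have "\<dots> = (\<Prod>j\<in>{..<k}. 1 / real CARD('b))"
    proof (intro prod.cong refl)
      fix j
      have "idx j -` {l ! j} \<inter> space M = {w \<in> space M. idx j w = l ! j}" by auto
      then show "prob (idx j -` {l ! j} \<inter> space M) = 1 / real CARD('b)"
        by (simp only: idx_uniform)
    qed
    finally show ?thesis by simp
  qed
qed

text \<open>An event of positive probability is nonempty; this supplies the representatives chosen
  by \<open>sample\<close>.\<close>

lemma hist_realised: "\<exists>w\<in>space M. hist (length l) w = l"
proof (rule ccontr)
  assume "\<not> ?thesis"
  then have "{w \<in> space M. hist (length l) w = l} = {}" by auto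
  then have "prob {w \<in> space M. hist (length l) w = l} = 0"
    by (simp only: measure_empty)
  then show False
    by (simp add: hist_event(2)[OF refl])
qed

text \<open>The histories of length \<open>k\<close> split the space into finitely many events of
  equal probability.\<close>

lemma has_bochner_integral_hist:
  fixes G :: "'b list \<Rightarrow> real"
  shows "has_bochner_integral M (\<lambda>w. G (hist k w)) ((1 / real CARD('b)) ^ k * (\<Sum>l | length l = k. G l))"
proof -
  define A where "A l = {w \<in> space M. hist k w = l}" for l
  have fin: "finite {l :: 'b list. length l = k}"
    using finite_lists_length_eq[of "UNIV :: 'b set" k] by simp
  have "has_bochner_integral M (\<lambda>w. \<Sum>l | length l = k. G l * indicator (A l) w)
      (\<Sum>l | length l = k. G l * prob (A l))"
    by (intro has_bochner_integral_sum has_bochner_integral_mult_right has_bochner_integral_real_indicator)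
       (auto simp: A_def hist_event(1) emeasure_eq_measure)
  moreover have "(\<Sum>l | length l = k. G l * indicator (A l) w) = G (hist k w)" if "w \<in> space M" for w
  proof -
    have "(\<Sum>l | length l = k. G l * indicator (A l) w) = (\<Sum>l | length l = k. if l = hist k w then G l else 0)"
      using that by (intro sum.cong) (auto simp: A_def indicator_def)
    also have "\<dots> = G (hist k w)"
      using fin by (simp add: sum.delta')
    finally show ?thesis .
  qed
  moreover have "(\<Sum>l | length l = k. G l * prob (A l)) = (1 / real CARD('b)) ^ k * (\<Sum>l | length l = k. G l)"
    unfolding sum_distrib_left A_def by (intro sum.cong) (auto simp: hist_event(2))
  ultimately show ?thesis
    by (simp cong: has_bochner_integral_cong)
qed

end

section \<open>The random iterates as functions of the finite history\<close>

locale apcg_process =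
  apcg_problem blk \<Psi> \<Psi>s x\<^sub>0 \<mu> \<gamma>\<^sub>0 \<alpha> \<beta> \<gamma> f L + uniform_choices M idx
  for blk :: "'N::finite \<Rightarrow> 'b::finite" and \<Psi> \<Psi>s x\<^sub>0 \<mu> \<gamma>\<^sub>0 \<alpha> \<beta> \<gamma> f L
    and M :: "'w measure" and idx :: "nat \<Rightarrow> 'w \<Rightarrow> 'b" +
  fixes x y z :: "nat \<Rightarrow> 'w \<Rightarrow> real ^ 'N"
  assumes runs: "\<And>w. w \<in> space M \<Longrightarrow> run (\<lambda>j. idx j w) (\<lambda>j. x j w) (\<lambda>j. y j w) (\<lambda>j. z j w)"
begin

text \<open>By \<open>run_determined\<close> the state at time \<open>length l\<close> is the same
  for every outcome with history \<open>l\<close>. Passing to a representative makes it a function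
  of the history, whence integrability.\<close>

definition sample :: "'b list \<Rightarrow> 'w" where
  "sample l = (SOME w. w \<in> space M \<and> hist (length l) w = l)"

lemma sample: "sample l \<in> space M" "hist (length l) (sample l) = l"
  using someI_ex[OF hist_realised[of l, unfolded Bex_def]] by (auto simp: sample_def)

abbreviation pot :: "real ^ 'N \<Rightarrow> nat \<Rightarrow> 'w \<Rightarrow> real" where
  "pot u k w \<equiv> potential (\<lambda>j. x j w) (\<lambda>j. z j w) u k"

lemma idx_sample:
  assumes "j < k"
  shows "idx j w = idx j (sample (hist k w))"
proof -
  have "hist k w = hist k (sample (hist k w))"
    using sample(2)[of "hist k w"] by simp
  then show ?thesis
    using assms unfolding hist_eq_iff by blast
qed

lemma pot_hist:
  assumes "w \<in> space M"
  shows "pot u k w = pot u k (sample (hist k w))"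
  using runs[OF assms] runs[OF sample(1)] idx_sample by (rule run_potential_cong)

lemma x_hist:
  assumes "w \<in> space M"
  shows "x k w = x k (sample (hist k w))"
  using run_determined[OF runs[OF assms] runs[OF sample(1)] idx_sample] by blast

lemma has_bochner_integral_pot:
  "has_bochner_integral M (pot u k) ((1 / real CARD('b)) ^ k * (\<Sum>l | length l = k. pot u k (sample l)))"
  by (subst has_bochner_integral_cong[OF refl pot_hist refl], assumption, rule has_bochner_integral_hist)

text \<open>The left side is the expected potential. Histories of length \<open>Suc k\<close> are
  grouped by their first \<open>k\<close> entries, and \<open>potential_step\<close> applies to each
  group.\<close>

lemma expected_pot_le:
  assumes u: "u \<in> ext_dom \<Psi>"
  shows "(1 / real CARD('b)) ^ k * (\<Sum>l | length l = k. pot u k (sample l))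
    \<le> contraction k * (f x\<^sub>0 + val x\<^sub>0 - (f u + val u) + \<gamma>\<^sub>0 / 2 * dist2 x\<^sub>0 u)"
proof (induction k)
  case 0
  show ?case
    using run_0[OF runs[OF sample(1)]] by (simp add: contraction_def potential_def gamma0_eq)
next
  case (Suc k)
  have "(\<Sum>i\<in>UNIV. pot u (Suc k) (sample (l @ [i]))) \<le> real CARD('b) * ((1 - \<alpha> k) * pot u k (sample l))"
    if l: "length l = k" for l
  proof (rule potential_step[OF runs[OF sample(1)] _ runs[OF sample(1)] _ u])
    fix i
    have h: "hist k (sample (l @ [i])) = l" "idx k (sample (l @ [i])) = i"
      using sample(2)[of "l @ [i]"] l by (auto simp: hist_Suc)
    show "idx k (sample (l @ [i])) = i" by (rule h)
    fix j assume "j < k"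
    moreover have "hist k (sample (l @ [i])) = hist k (sample l)"
      using h(1) sample(2)[of l] l by simp
    ultimately show "idx j (sample (l @ [i])) = idx j (sample l)"
      by (simp add: hist_eq_iff)
  qed
  then have "(\<Sum>l | length l = Suc k. pot u (Suc k) (sample l))
      \<le> (\<Sum>l | length l = k. real CARD('b) * ((1 - \<alpha> k) * pot u k (sample l)))"
    unfolding lists_length_Suc_sum by (intro sum_mono) auto
  then have "(1 / real CARD('b)) ^ Suc k * (\<Sum>l | length l = Suc k. pot u (Suc k) (sample l))
      \<le> (1 / real CARD('b)) ^ Suc k * (real CARD('b) * ((1 - \<alpha> k) * (\<Sum>l | length l = k. pot u k (sample l))))"
    unfolding sum_distrib_left[symmetric] by (intro mult_left_mono) auto
  also have "\<dots> = (1 - \<alpha> k) * ((1 / real CARD('b)) ^ k * (\<Sum>l | length l = k. pot u k (sample l)))"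
    by simp
  also have "\<dots> \<le> (1 - \<alpha> k) * (contraction k * (f x\<^sub>0 + val x\<^sub>0 - (f u + val u) + \<gamma>\<^sub>0 / 2 * dist2 x\<^sub>0 u))"
    using Suc alpha_le_1[of k] by (intro mult_left_mono) auto
  finally show ?case
    by (simp only: contraction_Suc mult.assoc)
qed

lemma integrable_objective: "integrable M (\<lambda>w. f (x k w) + val (x k w))"
proof -
  let ?G = "\<lambda>l. f (x k (sample l)) + val (x k (sample l))"
  have "integrable M (\<lambda>w. ?G (hist k w))"
    using has_bochner_integral_hist[of ?G k] by (rule integrable.intros)
  then show ?thesis
    by (rule Bochner_Integration.integrable_cong[THEN iffD1, rotated 2]) (simp_all flip: x_hist)
qed

lemma expected_objective_le:
  assumes u: "u \<in> ext_dom \<Psi>"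
  shows "expectation (\<lambda>w. f (x k w) + val (x k w)) - (f u + val u)
    \<le> contraction k * (f x\<^sub>0 + val x\<^sub>0 - (f u + val u) + \<gamma>\<^sub>0 / 2 * dist2 x\<^sub>0 u)"
proof -
  have pot: "integrable M (pot u k)"
    using has_bochner_integral_pot by (rule integrable.intros)
  have "expectation (\<lambda>w. f (x k w) + val (x k w)) \<le> expectation (\<lambda>w. pot u k w + (f u + val u))"
  proof (rule integral_mono[OF integrable_objective])
    show "integrable M (\<lambda>w. pot u k w + (f u + val u))"
      using pot by simp
    fix w assume "w \<in> space M"
    moreover have "0 \<le> \<gamma> k / 2 * dist2 (z k w) u"
      using gamma_pos[of k] by simp
    ultimately show "f (x k w) + val (x k w) \<le> pot u k w + (f u + val u)"
      using run_val_le[OF runs, of w k] by (simp add: potential_def)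
  qed
  also have "\<dots> = expectation (pot u k) + (f u + val u)"
    using pot by (simp add: prob_space)
  also have "expectation (pot u k) \<le> contraction k * (f x\<^sub>0 + val x\<^sub>0 - (f u + val u) + \<gamma>\<^sub>0 / 2 * dist2 x\<^sub>0 u)"
    using expected_pot_le[OF u] has_bochner_integral_integral_eq[OF has_bochner_integral_pot] by simp
  finally show ?thesis by simp
qed

end

section \<open>Extended-real expectation, infimum of distances, and conclusion\<close>

lemma ext_expectation_integrable:
  assumes "integrable M Y" "\<And>w. w \<in> space M \<Longrightarrow> X w = ereal (Y w)"
  shows "ext_expectation M X = ereal (integral\<^sup>L M Y)"
proof -
  have pos: "(\<integral>\<^sup>+ w. e2ennreal (X w) \<partial>M) = (\<integral>\<^sup>+ w. ennreal (Y w) \<partial>M)"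
    and neg: "(\<integral>\<^sup>+ w. e2ennreal (- X w) \<partial>M) = (\<integral>\<^sup>+ w. ennreal (- Y w) \<partial>M)"
    using assms(2) by (auto intro!: nn_integral_cong simp: ennreal.abs_eq e2ennreal_def ennreal_def)
  \<comment> \<open>Both parts are finite, so no difference of infinities arises.\<close>
  obtain p q where "(\<integral>\<^sup>+ w. ennreal (Y w) \<partial>M) = ennreal p" "0 \<le> p"
    "(\<integral>\<^sup>+ w. ennreal (- Y w) \<partial>M) = ennreal q" "0 \<le> q"
    using real_integrable_def[of M Y] assms(1) by (metis ennreal_cases infinity_ennreal_def)
  then show ?thesis
    by (simp add: ext_expectation_def pos neg real_lebesgue_integral_def[OF assms(1)] enn2ereal_ennreal)
qed

text \<open>The infimum is approximated: some \<open>u\<close> has \<open>N u < R + e\<close>, and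
  \<open>e\<close> then tends to 0 by continuity.\<close>

lemma le_quadratic_INF:
  fixes N :: "'a \<Rightarrow> real"
  assumes "S \<noteq> {}" and nonneg: "\<And>u. u \<in> S \<Longrightarrow> 0 \<le> N u" and "0 \<le> b"
    and le: "\<And>u. u \<in> S \<Longrightarrow> c \<le> a + b * (N u)\<^sup>2"
  shows "c \<le> a + b * (INF u\<in>S. N u)\<^sup>2"
proof -
  define R where "R = (INF u\<in>S. N u)"
  have "c \<le> a + b * (R + 0)\<^sup>2"
  proof (rule tendsto_lowerbound)
    show "((\<lambda>e. a + b * (R + e)\<^sup>2) \<longlongrightarrow> a + b * (R + 0)\<^sup>2) (at_right 0)"
      by (intro tendsto_intros)
    have "c \<le> a + b * (R + e)\<^sup>2" if e: "0 < e" for e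
    proof -
      have "bdd_below (N ` S)"
        using nonneg by (intro bdd_belowI[of _ 0]) auto
      then obtain u where u: "u \<in> S" "N u < R + e"
        using cINF_less_iff[OF \<open>S \<noteq> {}\<close>, of N "R + e"] e by (auto simp: R_def)
      have "c \<le> a + b * (N u)\<^sup>2" by (rule le[OF u(1)])
      also have "\<dots> \<le> a + b * (R + e)\<^sup>2"
        using u nonneg \<open>0 \<le> b\<close> by (intro add_left_mono mult_left_mono power_mono) auto
      finally show ?thesis .
    qed
    then show "\<forall>\<^sub>F e in at_right 0. c \<le> a + b * (R + e)\<^sup>2"
      unfolding eventually_at_right_field by (intro exI[of _ 1]) auto
  qed simp
  then show ?thesis by (simp add: R_def)
qed

theorem theorem1:
  fixes blk :: "'N::finite \<Rightarrow> 'b::finite"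
    and f :: "real ^ 'N \<Rightarrow> real"
    and \<Psi> F :: "real ^ 'N \<Rightarrow> ereal"
    and \<Psi>s :: "'b \<Rightarrow> real ^ 'N \<Rightarrow> ereal"
    and L :: "'b \<Rightarrow> real"
    and \<mu> \<gamma>\<^sub>0 R\<^sub>0 :: real
    and \<alpha> \<beta> \<gamma> :: "nat \<Rightarrow> real"
    and x\<^sub>0 :: "real ^ 'N"
    and M :: "'w measure"
    and idx :: "nat \<Rightarrow> 'w \<Rightarrow> 'b"
    and x y z :: "nat \<Rightarrow> 'w \<Rightarrow> real ^ 'N"
    and k :: nat
  assumes blocks: "surj blk"
    and f_convex: "convex_on UNIV f"
    and f_diff: "\<And>u. f differentiable (at u)"
    and Psi: "proper_fun \<Psi>" "lower_semicontinuous \<Psi>" "ext_convex \<Psi>"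
    and Psi_block: "\<And>i u. \<Psi>s i (block_part blk i u) \<noteq> -\<infinity>"
    and Psi_sep: "\<And>u. \<Psi> u = (\<Sum>i\<in>UNIV. \<Psi>s i (block_part blk i u))"
    and L_pos: "\<And>i. L i > 0"
    and smooth: "\<And>i u h.
          norm (block_part blk i (grad f (u + block_part blk i h)) - block_part blk i (grad f u))
            \<le> L i * norm (block_part blk i h)"
    and mu_nonneg: "\<mu> \<ge> 0"
    and strong_convex: "\<And>u v. u \<in> ext_dom \<Psi> \<Longrightarrow>
          f v \<ge> f u + grad f u \<bullet> (v - u) + \<mu> / 2 * (block_norm blk L (v - u))\<^sup>2"
    and F_eq: "\<And>u. F u = ereal (f u) + \<Psi> u"
    and opt_nonempty: "opt_set F \<noteq> {}"
    and x0_dom: "x\<^sub>0 \<in> ext_dom \<Psi>"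
    and R0_eq: "R\<^sub>0 = (INF u\<in>opt_set F. block_norm blk L (x\<^sub>0 - u))"
    and gamma0: "\<gamma>\<^sub>0 > 0" "\<gamma>\<^sub>0 \<in> {\<mu>..1}"
    and params: "apcg_params CARD('b) \<mu> \<gamma>\<^sub>0 \<alpha> \<beta> \<gamma>"
    and prob: "prob_space M"
    and idx_indep: "prob_space.indep_vars M (\<lambda>_. count_space UNIV) idx UNIV"
    and idx_uniform: "\<And>j i. measure M {w \<in> space M. idx j w = i} = 1 / real CARD('b)"
    and run: "\<And>w. w \<in> space M \<Longrightarrow>
          apcg_run blk f \<Psi>s L \<mu> \<alpha> \<beta> \<gamma> x\<^sub>0 (\<lambda>j. idx j w) (\<lambda>j. x j w) (\<lambda>j. y j w) (\<lambda>j. z j w)"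
  shows "ext_expectation M (\<lambda>w. F (x k w)) - opt_value F
          \<le> ereal (min ((1 - sqrt \<mu> / real CARD('b)) ^ k)
                       ((2 * real CARD('b) / (2 * real CARD('b) + real k * sqrt \<gamma>\<^sub>0))\<^sup>2))
            * (F x\<^sub>0 - opt_value F + ereal (\<gamma>\<^sub>0 / 2 * R\<^sub>0\<^sup>2))"
proof -
  interpret apcg_process blk \<Psi> \<Psi>s x\<^sub>0 \<mu> \<gamma>\<^sub>0 \<alpha> \<beta> \<gamma> f L M idx x y z
  proof (intro apcg_process.intro apcg_problem.intro uniform_choices.intro separable_regularizer.intro
      apcg_parameters.intro apcg_problem_axioms.intro uniform_choices_axioms.intro apcg_process_axioms.intro)
    show "GDERIV f u :> grad f u" for u
      by (rule GDERIV_grad[OF f_diff])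
  qed (fact Psi(3) Psi_block Psi_sep x0_dom params mu_nonneg gamma0 L_pos smooth strong_convex
        prob idx_indep idx_uniform run zero_less_card_finite)+
  define c where "c = min ((1 - sqrt \<mu> / real CARD('b)) ^ k)
      ((2 * real CARD('b) / (2 * real CARD('b) + real k * sqrt \<gamma>\<^sub>0))\<^sup>2)"
  have contr: "0 \<le> contraction k" "contraction k \<le> c"
    using contraction_nonneg contraction_le_linear contraction_le_sublinear by (simp_all add: c_def)
  have F_real: "F u = ereal (f u + val u)" if "u \<in> ext_dom \<Psi>" for u
    by (simp add: F_eq Psi_eq[OF that])
  have opt_dom: "u \<in> ext_dom \<Psi>" if "u \<in> opt_set F" for u
  proof -
    have "F u \<le> F x\<^sub>0"
      using that by (simp add: opt_set_def opt_value_def INF_lower)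
    then have "F u < \<infinity>"
      unfolding F_real[OF x0_dom] by (rule le_less_trans) simp
    then show ?thesis by (auto simp: F_eq ext_dom_def less_top)
  qed
  obtain u\<^sub>0 where u0: "u\<^sub>0 \<in> opt_set F"
    using opt_nonempty by blast
  define Fopt where "Fopt = f u\<^sub>0 + val u\<^sub>0"
  have opt: "opt_value F = ereal Fopt"
    using u0 F_real[OF opt_dom[OF u0]] by (simp add: opt_set_def Fopt_def)
  have F_opt: "f u + val u = Fopt" if "u \<in> opt_set F" for u
    using that F_real[OF opt_dom[OF that]] by (simp add: opt_set_def opt)
  define E where "E = expectation (\<lambda>w. f (x k w) + val (x k w))"
  have E: "ext_expectation M (\<lambda>w. F (x k w)) = ereal E"
    unfolding E_def
    by (rule ext_expectation_integrable[OF integrable_objective F_real[OF run_in_dom(1)[OF runs]]])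
  define \<Delta> where "\<Delta> = f x\<^sub>0 + val x\<^sub>0 - Fopt"
  \<comment> \<open>Needed to replace the factor \<open>contraction k\<close> by the larger
    \<open>c\<close>.\<close>
  have "0 \<le> \<Delta>"
  proof -
    have "opt_value F \<le> F x\<^sub>0" by (simp add: opt_value_def INF_lower)
    then show ?thesis by (simp add: opt F_real[OF x0_dom] \<Delta>_def)
  qed
  have "E - Fopt \<le> c * \<Delta> + c * (\<gamma>\<^sub>0 / 2) * (INF u\<in>opt_set F. block_norm blk L (x\<^sub>0 - u))\<^sup>2"
  proof (rule le_quadratic_INF[OF opt_nonempty])
    show "0 \<le> block_norm blk L (x\<^sub>0 - u)" for u
      unfolding block_norm_def by (intro real_sqrt_ge_zero sum_nonneg mult_nonneg_nonneg less_imp_le[OF L_pos]) simp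
    show "0 \<le> c * (\<gamma>\<^sub>0 / 2)"
      using contr gamma0 by simp
    fix u assume u: "u \<in> opt_set F"
    have "E - Fopt \<le> contraction k * (\<Delta> + \<gamma>\<^sub>0 / 2 * dist2 x\<^sub>0 u)"
      using expected_objective_le[OF opt_dom[OF u], of k] by (simp only: F_opt[OF u] E_def \<Delta>_def)
    also have "\<dots> \<le> c * (\<Delta> + \<gamma>\<^sub>0 / 2 * dist2 x\<^sub>0 u)"
      using contr \<open>0 \<le> \<Delta>\<close> gamma0 by (intro mult_right_mono) auto
    finally show "E - Fopt \<le> c * \<Delta> + c * (\<gamma>\<^sub>0 / 2) * dist2 x\<^sub>0 u"
      by (simp only: distrib_left mult.assoc)
  qed
  then have "E - Fopt \<le> c * (\<Delta> + \<gamma>\<^sub>0 / 2 * R\<^sub>0\<^sup>2)"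
    unfolding R0_eq by (simp only: distrib_left mult.assoc)
  then show ?thesis
    unfolding c_def[symmetric] E opt F_real[OF x0_dom] by (simp add: \<Delta>_def)
qed

end
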